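(* Let $\Lambda$ be any subgroup of $\mathrm{SL}(2,\mathbb Z)$ containing a hyperbolic element. Any sequence $(\Gamma_n)_n$ of finite index subgroups of $\Gamma:=\Lambda\ltimes\mathbb Z^2$ such that $[\mathbb Z^2:\Gamma_n\cap\mathbb Z^2]\to\infty$ as $n\to\infty$ defines a sofic approximation of $\Gamma$ (via the actions $\Gamma\curvearrowright\Gamma/\Gamma_n$), and $$\lim_{n\to\infty}\frac{\mathrm{rank}(\Gamma_n)-1}{[\Gamma:\Gamma_n]}=0.$$
   Context: $\mathrm{rank}$ denotes the minimal number of generators. The semidirect product is with respect to the standard linear action on $\mathbb Z^2$. An element of $\mathrm{SL}(2,\mathbb Z)$ is hyperbolic if the absolute value of its trace is greater than $2$. A sequence of actions $\Gamma\curvearrowright\Gamma/\Gamma_n$ on finite coset spaces (with uniform probability measures) defines a sofic approximation of $\Gamma$ if for every non-principal ultrafilter $\mathfrak u$ on $\mathbb N$ the ultraproduct action of $\Gamma$ on the Loeb probability space $\prod_n(\Gamma/\Gamma_n)/\mathfrak u$, $\gamma[x_n]_{\mathfrak u}=[\gamma x_n]_{\mathfrak u}$, is essentially free; equivalently, for every $\gamma\in\Gamma\setminus\{1\}$, $\frac{|\{x\in\Gamma/\Gamma_n:\gamma x=x\}|}{[\Gamma:\Gamma_n]}\to0$ as $n\to\infty$.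
   Formalization: The rank limit is stated only for finitely generated Γ (equivalently, finitely generated Λ); otherwise every finite index subgroup Γ_n has infinite rank and the limit claim fails, e.g. Γ_n = Λ⋉nℤ² with Λ free of infinite rank. Soficity is stated for all Λ. *)

theory Defs
  imports "HOL-Analysis.Analysis" "HOL-Algebra.Left_Coset" "HOL-Algebra.Generated_Groups"
begin

section \<open>Ultraproducts of finite sets and the Loeb measure\<close>

definition nonprincipal_ultrafilter :: "nat filter \<Rightarrow> bool" where
  "nonprincipal_ultrafilter U \<longleftrightarrow>
     U \<noteq> bot \<and> (\<forall>P. eventually P U \<or> eventually (\<lambda>n. \<not> P n) U) \<and> (\<forall>k. U \<noteq> principal {k})"

definition ultra_rel :: "nat filter \<Rightarrow> (nat \<Rightarrow> 'a set) \<Rightarrow> ((nat \<Rightarrow> 'a) \<times> (nat \<Rightarrow> 'a)) set" where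
  "ultra_rel U X = {(x, y). x \<in> Pi UNIV X \<and> y \<in> Pi UNIV X \<and> (\<forall>\<^sub>F n in U. x n = y n)}"

definition ultraproduct :: "nat filter \<Rightarrow> (nat \<Rightarrow> 'a set) \<Rightarrow> (nat \<Rightarrow> 'a) set set" where
  "ultraproduct U X = Pi UNIV X // ultra_rel U X"

definition internal_set ::
    "nat filter \<Rightarrow> (nat \<Rightarrow> 'a set) \<Rightarrow> (nat \<Rightarrow> 'a set) \<Rightarrow> (nat \<Rightarrow> 'a) set set" where
  "internal_set U X A = {ultra_rel U X `` {x} | x. x \<in> Pi UNIV X \<and> (\<forall>\<^sub>F n in U. x n \<in> A n)}"

text \<open>
  The measure on the \<open>\<sigma>\<close>-algebra generated by the internal sets which extends the ultralimit of
  the uniform probability measures on the \<open>X n\<close>.  That this extension exists, so that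
  \<^const>\<open>extend_measure\<close> does not fall back to the zero measure, is \<open>emeasure_loeb_internal\<close> below.
\<close>
definition loeb_measure :: "nat filter \<Rightarrow> (nat \<Rightarrow> 'a set) \<Rightarrow> (nat \<Rightarrow> 'a) set measure" where
  "loeb_measure U X =
     extend_measure (ultraproduct U X) {A. \<forall>n. A n \<subseteq> X n} (internal_set U X)
       (\<lambda>A. ennreal (Lim U (\<lambda>n. real (card (A n)) / real (card (X n)))))"

text \<open>
  The map sending the class of \<open>(x\<^sub>n)\<close> to the class of \<open>(g \<cdot> x\<^sub>n)\<close>; all members of the union agree.
\<close>
definition ultra_action ::
    "nat filter \<Rightarrow> (nat \<Rightarrow> 'a set) \<Rightarrow> (nat \<Rightarrow> 'g \<Rightarrow> 'a \<Rightarrow> 'a) \<Rightarrow> 'g \<Rightarrow> (nat \<Rightarrow> 'a) set \<Rightarrow> (nat \<Rightarrow> 'a) set"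
  where "ultra_action U X act g c = (\<Union>x\<in>c. ultra_rel U X `` {\<lambda>n. act n g (x n)})"


section \<open>Sofic approximations\<close>

definition essentially_free ::
    "('g, 'm) monoid_scheme \<Rightarrow> 'b measure \<Rightarrow> ('g \<Rightarrow> 'b \<Rightarrow> 'b) \<Rightarrow> bool" where
  "essentially_free G M act \<longleftrightarrow> (AE x in M. \<forall>g\<in>carrier G - {\<one>\<^bsub>G\<^esub>}. act g x \<noteq> x)"

definition sofic_approximation ::
    "('g, 'm) monoid_scheme \<Rightarrow> (nat \<Rightarrow> 'a set) \<Rightarrow> (nat \<Rightarrow> 'g \<Rightarrow> 'a \<Rightarrow> 'a) \<Rightarrow> bool" where
  "sofic_approximation G X act \<longleftrightarrow>
     (\<forall>U. nonprincipal_ultrafilter U \<longrightarrow>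
        essentially_free G (loeb_measure U X) (ultra_action U X act))"


subsection \<open>The Loeb measure extends the internal measures\<close>

context
  fixes U :: "nat filter"
  assumes U: "nonprincipal_ultrafilter U"
begin

lemma ultra_not_bot: "U \<noteq> bot"
  using U by (simp add: nonprincipal_ultrafilter_def)

lemma ultra_not: "(\<forall>\<^sub>F n in U. \<not> P n) \<longleftrightarrow> \<not> (\<forall>\<^sub>F n in U. P n)"
proof -
  have "\<not> ((\<forall>\<^sub>F n in U. P n) \<and> (\<forall>\<^sub>F n in U. \<not> P n))"
  proof
    assume "(\<forall>\<^sub>F n in U. P n) \<and> (\<forall>\<^sub>F n in U. \<not> P n)"
    then have "\<forall>\<^sub>F n in U. P n" "\<forall>\<^sub>F n in U. \<not> P n" by auto
    then have "\<forall>\<^sub>F n in U. False" by eventually_elim simp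
    then show False using ultra_not_bot by (simp add: trivial_limit_def)
  qed
  then show ?thesis using U unfolding nonprincipal_ultrafilter_def by blast
qed

lemma ultra_disj: "(\<forall>\<^sub>F n in U. P n \<or> Q n) \<longleftrightarrow> (\<forall>\<^sub>F n in U. P n) \<or> (\<forall>\<^sub>F n in U. Q n)"
proof -
  have "(\<forall>\<^sub>F n in U. \<not> (P n \<or> Q n)) \<longleftrightarrow> (\<forall>\<^sub>F n in U. \<not> P n) \<and> (\<forall>\<^sub>F n in U. \<not> Q n)"
    by (simp add: eventually_conj_iff)
  then show ?thesis unfolding ultra_not by blast
qed

lemma ultra_le_sequentially: "U \<le> sequentially"
proof (rule filter_leI)
  fix P assume "eventually P sequentially"
  then obtain K where K: "\<And>n. n \<ge> K \<Longrightarrow> P n" by (auto simp: eventually_sequentially)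
  have ne: "\<forall>\<^sub>F n in U. n \<noteq> k" for k
  proof (rule ccontr)
    assume "\<not> (\<forall>\<^sub>F n in U. n \<noteq> k)"
    then have k: "\<forall>\<^sub>F n in U. n = k" using ultra_not[of "\<lambda>n. n = k"] by blast
    have "eventually Q U \<longleftrightarrow> Q k" for Q
    proof
      assume "eventually Q U"
      with k have "\<forall>\<^sub>F n in U. Q k" by eventually_elim simp
      then show "Q k" using ultra_not_bot by (simp add: eventually_const_iff)
    next
      assume "Q k"
      with k show "eventually Q U" by (auto elim: eventually_mono)
    qed
    then have "U = principal {k}" by (simp add: filter_eq_iff eventually_principal)
    then show False using U by (simp add: nonprincipal_ultrafilter_def)
  qed
  have "\<forall>\<^sub>F n in U. \<forall>k\<in>{..<K}. n \<noteq> k"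
    by (rule eventually_ball_finite) (use ne in auto)
  then show "eventually P U"
    by (rule eventually_mono) (use K not_le in blast)
qed

lemma ultra_limit_exists:
  fixes f :: "nat \<Rightarrow> real"
  assumes "\<And>n. f n \<in> {0..1}"
  shows "(f \<longlongrightarrow> Lim U f) U"
proof -
  have "compact {0..1::real}" by simp
  moreover have "filtermap f U \<noteq> bot" using ultra_not_bot by (simp add: filtermap_bot_iff)
  moreover have "eventually (\<lambda>x. x \<in> {0..1}) (filtermap f U)"
    using assms by (simp add: eventually_filtermap)
  ultimately obtain l where l: "inf (nhds l) (filtermap f U) \<noteq> bot"
    unfolding compact_filter by blast
  have "(f \<longlongrightarrow> l) U"
  proof (rule topological_tendstoI)
    fix S assume S: "open S" "l \<in> S"
    show "\<forall>\<^sub>F n in U. f n \<in> S"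
    proof (rule ccontr)
      assume "\<not> ?thesis"
      then have "\<forall>\<^sub>F x in filtermap f U. x \<notin> S"
        using ultra_not[of "\<lambda>n. f n \<in> S"] by (simp add: eventually_filtermap)
      moreover have "\<forall>\<^sub>F x in nhds l. x \<in> S" using S by (rule eventually_nhds_in_open)
      ultimately have "\<forall>\<^sub>F x in inf (nhds l) (filtermap f U). False"
        unfolding eventually_inf by blast
      then show False using l by (simp add: trivial_limit_def)
    qed
  qed
  then show ?thesis using tendsto_Lim[OF ultra_not_bot] by blast
qed

context
  fixes X :: "nat \<Rightarrow> 'a set"
  assumes finite_X: "\<And>n. finite (X n)" and nonempty_X: "\<And>n. X n \<noteq> {}"
begin

lemma equiv_ultra_rel: "equiv (Pi UNIV X) (ultra_rel U X)"
proof (rule equivI)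
  show "trans (ultra_rel U X)"
  proof (rule transI)
    fix x y z assume "(x, y) \<in> ultra_rel U X" "(y, z) \<in> ultra_rel U X"
    then have xz: "x \<in> Pi UNIV X" "z \<in> Pi UNIV X"
      and e: "\<forall>\<^sub>F n in U. x n = y n" "\<forall>\<^sub>F n in U. y n = z n"
      by (auto simp: ultra_rel_def)
    from e have "\<forall>\<^sub>F n in U. x n = z n" by eventually_elim simp
    with xz show "(x, z) \<in> ultra_rel U X" by (simp add: ultra_rel_def)
  qed
qed (auto simp: ultra_rel_def refl_on_def sym_def eq_commute)

lemma ultra_class_eq:
  assumes "x \<in> Pi UNIV X" "y \<in> Pi UNIV X"
  shows "ultra_rel U X `` {x} = ultra_rel U X `` {y} \<longleftrightarrow> (\<forall>\<^sub>F n in U. x n = y n)"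
  using eq_equiv_class_iff[OF equiv_ultra_rel assms] assms by (simp add: ultra_rel_def)

lemma ultra_class_in_internal:
  assumes x: "x \<in> Pi UNIV X"
  shows "ultra_rel U X `` {x} \<in> internal_set U X A \<longleftrightarrow> (\<forall>\<^sub>F n in U. x n \<in> A n)"
proof
  assume "ultra_rel U X `` {x} \<in> internal_set U X A"
  then obtain y where y: "y \<in> Pi UNIV X" "ultra_rel U X `` {x} = ultra_rel U X `` {y}"
    and A: "\<forall>\<^sub>F n in U. y n \<in> A n" by (auto simp: internal_set_def)
  have "\<forall>\<^sub>F n in U. x n = y n" using y x ultra_class_eq by blast
  with A show "\<forall>\<^sub>F n in U. x n \<in> A n" by eventually_elim simp
qed (use x in \<open>auto simp: internal_set_def\<close>)

lemma ultra_set_eqI: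
  assumes "S \<subseteq> ultraproduct U X" "T \<subseteq> ultraproduct U X"
    and "\<And>x. x \<in> Pi UNIV X \<Longrightarrow> ultra_rel U X `` {x} \<in> S \<longleftrightarrow> ultra_rel U X `` {x} \<in> T"
  shows "S = T"
proof (rule Set.set_eqI)
  fix c
  show "c \<in> S \<longleftrightarrow> c \<in> T"
  proof (cases "c \<in> ultraproduct U X")
    case True
    then obtain x where "x \<in> Pi UNIV X" "c = ultra_rel U X `` {x}"
      unfolding ultraproduct_def by (rule quotientE)
    then show ?thesis using assms(3) by blast
  qed (use assms(1,2) in blast)
qed

lemma internal_subset: "internal_set U X A \<subseteq> ultraproduct U X"
  by (auto simp: internal_set_def ultraproduct_def quotientI)

lemma internal_full: "internal_set U X X = ultraproduct U X"
  by (rule ultra_set_eqI[OF internal_subset order_refl])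
     (auto simp: ultra_class_in_internal ultraproduct_def quotientI Pi_iff)

lemma internal_empty: "internal_set U X (\<lambda>n. {}) = {}"
  using ultra_not_bot by (auto simp: internal_set_def trivial_limit_def)

lemma internal_Un:
  "internal_set U X (\<lambda>n. A n \<union> B n) = internal_set U X A \<union> internal_set U X B"
  by (rule ultra_set_eqI) (auto simp: ultra_class_in_internal ultra_disj internal_subset)

lemma internal_Int:
  "internal_set U X (\<lambda>n. A n \<inter> B n) = internal_set U X A \<inter> internal_set U X B"
  by (rule ultra_set_eqI)
     (use internal_subset in \<open>auto simp: ultra_class_in_internal eventually_conj_iff\<close>)

lemma internal_Diff:
  "internal_set U X (\<lambda>n. A n - B n) = internal_set U X A - internal_set U X B"
  by (rule ultra_set_eqI)
     (use internal_subset in \<open>auto simp: ultra_class_in_internal eventually_conj_iff ultra_not\<close>)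

lemma internal_subset_iff:
  assumes A: "\<And>n. A n \<subseteq> X n"
  shows "internal_set U X A \<subseteq> internal_set U X B \<longleftrightarrow> (\<forall>\<^sub>F n in U. A n \<subseteq> B n)"
proof
  assume sub: "internal_set U X A \<subseteq> internal_set U X B"
  show "\<forall>\<^sub>F n in U. A n \<subseteq> B n"
  proof (rule ccontr)
    assume "\<not> ?thesis"
    then have ev: "\<forall>\<^sub>F n in U. \<not> A n \<subseteq> B n" using ultra_not by blast
    have "\<exists>z. z \<in> X n \<and> (\<not> A n \<subseteq> B n \<longrightarrow> z \<in> A n - B n)" for n
      using A[of n] nonempty_X[of n] by blast
    then obtain x where x: "\<And>n. x n \<in> X n" "\<And>n. \<not> A n \<subseteq> B n \<Longrightarrow> x n \<in> A n - B n"
      by metis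
    have "\<forall>\<^sub>F n in U. x n \<in> A n - B n" using ev by eventually_elim (rule x)
    moreover have "x \<in> Pi UNIV X" using x by auto
    ultimately have "ultra_rel U X `` {x} \<in> internal_set U X (\<lambda>n. A n - B n)"
      using ultra_class_in_internal by blast
    then show False using sub by (auto simp: internal_Diff)
  qed
next
  assume ev: "\<forall>\<^sub>F n in U. A n \<subseteq> B n"
  show "internal_set U X A \<subseteq> internal_set U X B"
  proof
    fix c assume "c \<in> internal_set U X A"
    then obtain x where x: "x \<in> Pi UNIV X" "c = ultra_rel U X `` {x}" and e: "\<forall>\<^sub>F n in U. x n \<in> A n"
      by (auto simp: internal_set_def)
    from e ev have "\<forall>\<^sub>F n in U. x n \<in> B n" by eventually_elim auto
    then show "c \<in> internal_set U X B" using x by (auto simp: internal_set_def)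
  qed
qed

lemma internal_eq_iff:
  assumes "\<And>n. A n \<subseteq> X n" "\<And>n. B n \<subseteq> X n"
  shows "internal_set U X A = internal_set U X B \<longleftrightarrow> (\<forall>\<^sub>F n in U. A n = B n)"
  using internal_subset_iff[of A B] internal_subset_iff[of B A] assms
  unfolding set_eq_subset by (auto simp: eventually_conj_iff)

lemma internal_saturation:
  assumes A: "\<And>i n. A i n \<subseteq> X n"
    and dec: "\<And>i. internal_set U X (A (Suc i)) \<subseteq> internal_set U X (A i)"
    and ne: "\<And>i. internal_set U X (A i) \<noteq> {}"
  shows "(\<Inter>i. internal_set U X (A i)) \<noteq> {}"
proof -
  define B where "B i n = (\<Inter>j\<in>{..i}. A j n)" for i n
  have Bsub: "B j n \<subseteq> B i n" if "i \<le> j" for i j n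
    using that by (auto simp: B_def)
  have BX: "B i n \<subseteq> X n" for i n using A by (auto simp: B_def)
  have decseq: "decseq (\<lambda>i. internal_set U X (A i))" using dec by (rule decseq_SucI)
  have "\<forall>\<^sub>F n in U. B i n \<noteq> {}" for i
  proof -
    have "\<forall>\<^sub>F n in U. A i n \<subseteq> A j n" if "j \<le> i" for j
      using decseqD[OF decseq that] internal_subset_iff[of "A i" "A j"] A by blast
    then have "\<forall>\<^sub>F n in U. \<forall>j\<in>{..i}. A i n \<subseteq> A j n"
      by (intro eventually_ball_finite) auto
    moreover have "\<forall>\<^sub>F n in U. A i n \<noteq> {}"
    proof (rule ccontr)
      assume "\<not> ?thesis"
      then have "\<forall>\<^sub>F n in U. A i n = {}" using ultra_not[of "\<lambda>n. A i n = {}"] by blast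
      then have "internal_set U X (A i) = internal_set U X (\<lambda>n. {})"
        using A by (subst internal_eq_iff) auto
      then show False using ne internal_empty by simp
    qed
    ultimately show ?thesis
    proof eventually_elim
      case (elim n)
      then have "A i n \<subseteq> B i n" unfolding B_def by (intro INT_greatest) blast
      then show ?case using elim by auto
    qed
  qed
  note Bne = this
  define K where "K n = Max {i. i \<le> n \<and> B i n \<noteq> {}}" for n
  have "\<exists>z. z \<in> X n \<and> (B (K n) n \<noteq> {} \<longrightarrow> z \<in> B (K n) n)" for n
    using BX[of "K n" n] nonempty_X[of n] by blast
  then obtain x where x: "\<And>n. x n \<in> X n" "\<And>n. B (K n) n \<noteq> {} \<Longrightarrow> x n \<in> B (K n) n"
    by metis
  have xA: "\<forall>\<^sub>F n in U. x n \<in> A i n" for i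
  proof -
    have "\<forall>\<^sub>F n in U. i \<le> n"
      using ultra_le_sequentially eventually_ge_at_top[of i] by (rule filter_leD)
    with Bne[of i] show ?thesis
    proof eventually_elim
      case (elim n)
      let ?S = "{i. i \<le> n \<and> B i n \<noteq> {}}"
      have S: "finite ?S" "i \<in> ?S" using elim by auto
      then have "?S \<noteq> {}" by blast
      then have "K n \<in> ?S" unfolding K_def by (rule Max_in[OF S(1)])
      moreover have "i \<le> K n" unfolding K_def by (rule Max_ge[OF S])
      ultimately have "B (K n) n \<noteq> {}" "i \<le> K n" by simp_all
      then have "x n \<in> B i n" using x(2)[of n] Bsub[of i "K n" n] by auto
      then show ?case by (auto simp: B_def)
    qed
  qed
  have "x \<in> Pi UNIV X" using x by auto
  then have "ultra_rel U X `` {x} \<in> (\<Inter>i. internal_set U X (A i))"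
    using xA by (simp add: ultra_class_in_internal)
  then show ?thesis by blast
qed

lemma ultra_density_tendsto:
  assumes "\<And>n. A n \<subseteq> X n"
  shows "((\<lambda>n. real (card (A n)) / real (card (X n))) \<longlongrightarrow>
           Lim U (\<lambda>n. real (card (A n)) / real (card (X n)))) U"
  by (rule ultra_limit_exists)
     (use assms finite_X nonempty_X in
       \<open>auto simp: divide_le_eq_1 card_gt_0_iff intro!: card_mono\<close>)

lemma emeasure_loeb_internal:
  assumes "\<And>n. A n \<subseteq> X n"
  shows "emeasure (loeb_measure U X) (internal_set U X A) =
           ennreal (Lim U (\<lambda>n. real (card (A n)) / real (card (X n))))"
proof -
  define I where "I = {A. \<forall>n. A n \<subseteq> X n}"
  define r where "r A n = real (card (A n)) / real (card (X n))" for A :: "nat \<Rightarrow> 'a set" and n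
  define L where "L A = Lim U (r A)" for A
  have lim: "(r A \<longlongrightarrow> L A) U" if "A \<in> I" for A
    using ultra_density_tendsto[of A] that unfolding r_def L_def I_def by simp
  have limI: "L A = l" if "(r A \<longlongrightarrow> l) U" for A l
    unfolding L_def using that by (rule tendsto_Lim[OF ultra_not_bot])
  have L_nonneg: "0 \<le> L A" if "A \<in> I" for A
    by (rule tendsto_lowerbound[OF lim[OF that]]) (auto simp: r_def ultra_not_bot)
  have L_cong: "L A = L B" if "A \<in> I" "B \<in> I" "internal_set U X A = internal_set U X B" for A B
  proof -
    have "\<forall>\<^sub>F n in U. A n = B n" using that internal_eq_iff[of A B] by (simp add: I_def)
    then have "\<forall>\<^sub>F n in U. r A n = r B n" by eventually_elim (simp add: r_def)
    with lim[OF that(2)] have "(r A \<longlongrightarrow> L B) U" by (simp add: tendsto_cong)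
    then show ?thesis by (rule limI)
  qed
  define M where "M = internal_set U X ` I"
  define f where "f S = ennreal (L (SOME A. A \<in> I \<and> S = internal_set U X A))" for S
  have f: "f (internal_set U X A) = ennreal (L A)" if "A \<in> I" for A
  proof -
    let ?B = "SOME B. B \<in> I \<and> internal_set U X A = internal_set U X B"
    have "?B \<in> I \<and> internal_set U X A = internal_set U X ?B"
      by (rule someI[of _ A]) (use that in simp)
    then show ?thesis unfolding f_def using L_cong[OF that] by metis
  qed
  have empty_I: "(\<lambda>n. {}) \<in> I" by (simp add: I_def)
  have L_empty: "L (\<lambda>n. {}) = 0" by (rule limI) (simp add: r_def [abs_def])
  interpret M: ring_of_sets "ultraproduct U X" M
  proof (rule ring_of_setsI)
    show "M \<subseteq> Pow (ultraproduct U X)" using internal_subset by (auto simp: M_def)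
    show "{} \<in> M" using internal_empty empty_I unfolding M_def by (metis image_eqI)
    fix S T assume "S \<in> M" "T \<in> M"
    then obtain A B where AB: "A \<in> I" "B \<in> I" "S = internal_set U X A" "T = internal_set U X B"
      by (auto simp: M_def)
    then have "(\<lambda>n. A n \<union> B n) \<in> I" "(\<lambda>n. A n - B n) \<in> I" by (auto simp: I_def)
    then show "S \<union> T \<in> M" "S - T \<in> M"
      unfolding M_def AB internal_Un[symmetric] internal_Diff[symmetric] by auto
  qed
  have pos: "positive M f"
    using f[OF empty_I] by (simp add: positive_def internal_empty L_empty)
  have add: "additive M f"
  proof (unfold additive_def, intro ballI impI)
    fix S T assume "S \<in> M" "T \<in> M" and dis: "S \<inter> T = {}"
    then obtain A B where AB: "A \<in> I" "B \<in> I" "S = internal_set U X A" "T = internal_set U X B"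
      by (auto simp: M_def)
    have Un: "(\<lambda>n. A n \<union> B n) \<in> I" using AB by (auto simp: I_def)
    have "internal_set U X (\<lambda>n. A n \<inter> B n) = internal_set U X (\<lambda>n. {})"
      using dis AB by (simp add: internal_Int internal_empty)
    then have "\<forall>\<^sub>F n in U. A n \<inter> B n = {}"
      using AB by (subst (asm) internal_eq_iff) (auto simp: I_def)
    then have "\<forall>\<^sub>F n in U. r A n + r B n = r (\<lambda>n. A n \<union> B n) n"
    proof eventually_elim
      case (elim n)
      have "finite (A n)" "finite (B n)"
        using AB finite_subset[OF _ finite_X[of n]] by (simp_all add: I_def)
      then show ?case using elim by (simp add: r_def card_Un_disjoint add_divide_distrib)
    qed
    with tendsto_add[OF lim[OF AB(1)] lim[OF AB(2)]]
    have "(r (\<lambda>n. A n \<union> B n) \<longlongrightarrow> L A + L B) U" by (rule Lim_transform_eventually)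
    then have "L (\<lambda>n. A n \<union> B n) = L A + L B" by (rule limI)
    then show "f (S \<union> T) = f S + f T"
      unfolding AB internal_Un[symmetric] using f AB Un L_nonneg by simp
  qed
  have fin: "f S \<noteq> \<infinity>" if "S \<in> M" for S
    using that f by (auto simp: M_def)
  have cont: "(\<lambda>i. f (S i)) \<longlonglongrightarrow> 0" if S: "range S \<subseteq> M" "decseq S" "(\<Inter>i. S i) = {}" for S
  proof -
    have "\<forall>i. \<exists>A. A \<in> I \<and> S i = internal_set U X A" using S(1) by (auto simp: M_def)
    then obtain A where A: "\<And>i. A i \<in> I" "\<And>i. S i = internal_set U X (A i)" by metis
    have "\<exists>i. S i = {}"
      using internal_saturation[of A] A S(2,3) by (auto simp: I_def decseq_Suc_iff)
    then obtain i where "S i = {}" ..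
    then have "S j = {}" if "i \<le> j" for j using decseqD[OF S(2) that] by auto
    then have "\<forall>\<^sub>F j in sequentially. f (S j) = 0"
      using pos unfolding eventually_sequentially positive_def by metis
    then show ?thesis by (rule tendsto_eventually)
  qed
  obtain \<mu> :: "(nat \<Rightarrow> 'a) set set \<Rightarrow> ennreal" where \<mu>: "\<forall>S\<in>M. \<mu> S = f S"
    and ms: "measure_space (ultraproduct U X) (sigma_sets (ultraproduct U X) M) \<mu>"
    using M.caratheodory_empty_continuous[OF pos add fin cont] by blast
  have def: "loeb_measure U X =
      extend_measure (ultraproduct U X) I (internal_set U X) (\<lambda>A. ennreal (L A))"
    unfolding loeb_measure_def I_def L_def r_def ..
  have Pow: "internal_set U X ` I \<subseteq> Pow (ultraproduct U X)" using internal_subset by auto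
  have sets: "sets (loeb_measure U X) = sigma_sets (ultraproduct U X) M"
    unfolding def M_def using Pow by (rule sets_extend_measure)
  have "emeasure (loeb_measure U X) (internal_set U X A) = ennreal (L A)"
  proof (rule emeasure_extend_measure[OF def, where \<mu>' = \<mu>])
    show "\<mu> (internal_set U X B) = ennreal (L B)" if "B \<in> I" for B
      using \<mu> f that by (auto simp: M_def)
    show "positive (sets (loeb_measure U X)) \<mu>" "countably_additive (sets (loeb_measure U X)) \<mu>"
      using ms unfolding sets measure_space_def by auto
    show "A \<in> I" using assms by (simp add: I_def)
  qed (rule Pow)
  then show ?thesis by (simp add: L_def r_def [abs_def])
qed

lemma space_loeb: "space (loeb_measure U X) = ultraproduct U X"
  unfolding loeb_measure_def by (rule space_extend_measure) (use internal_subset in auto)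

lemma internal_in_sets_loeb:
  assumes "\<And>n. A n \<subseteq> X n"
  shows "internal_set U X A \<in> sets (loeb_measure U X)"
proof -
  have "sets (loeb_measure U X) =
      sigma_sets (ultraproduct U X) (internal_set U X ` {A. \<forall>n. A n \<subseteq> X n})"
    unfolding loeb_measure_def by (rule sets_extend_measure) (use internal_subset in auto)
  then show ?thesis using assms by auto
qed

lemma emeasure_loeb_space: "emeasure (loeb_measure U X) (space (loeb_measure U X)) = 1"
proof -
  have "(\<lambda>n. real (card (X n)) / real (card (X n))) = (\<lambda>n. 1)"
    using finite_X nonempty_X by auto
  then have "Lim U (\<lambda>n. real (card (X n)) / real (card (X n))) = 1"
    by (simp add: tendsto_Lim[OF ultra_not_bot])
  then show ?thesis
    using emeasure_loeb_internal[of X] by (simp add: space_loeb internal_full)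
qed

lemma ultra_action_class:
  assumes x: "x \<in> Pi UNIV X" and act: "\<And>n z. z \<in> X n \<Longrightarrow> act n g z \<in> X n"
  shows "ultra_action U X act g (ultra_rel U X `` {x}) = ultra_rel U X `` {\<lambda>n. act n g (x n)}"
proof -
  have "ultra_rel U X `` {\<lambda>n. act n g (y n)} = ultra_rel U X `` {\<lambda>n. act n g (x n)}"
    if "y \<in> ultra_rel U X `` {x}" for y
  proof -
    have y: "y \<in> Pi UNIV X" "\<forall>\<^sub>F n in U. x n = y n" using that by (auto simp: ultra_rel_def)
    have "\<forall>\<^sub>F n in U. act n g (y n) = act n g (x n)" using y(2) by eventually_elim simp
    moreover have "(\<lambda>n. act n g (y n)) \<in> Pi UNIV X" "(\<lambda>n. act n g (x n)) \<in> Pi UNIV X"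
      using x y act by auto
    ultimately show ?thesis by (simp add: ultra_class_eq)
  qed
  moreover have "x \<in> ultra_rel U X `` {x}" using x by (simp add: ultra_rel_def)
  ultimately show ?thesis unfolding ultra_action_def by blast
qed

lemma ultra_fixed_points:
  assumes act: "\<And>n z. z \<in> X n \<Longrightarrow> act n g z \<in> X n"
  shows "{c \<in> ultraproduct U X. ultra_action U X act g c = c} =
           internal_set U X (\<lambda>n. {z \<in> X n. act n g z = z})"
proof (rule ultra_set_eqI[OF _ internal_subset])
  fix x assume x: "x \<in> Pi UNIV X"
  have "(\<lambda>n. act n g (x n)) \<in> Pi UNIV X" using x act by auto
  then show "ultra_rel U X `` {x} \<in> {c \<in> ultraproduct U X. ultra_action U X act g c = c} \<longleftrightarrow>
      ultra_rel U X `` {x} \<in> internal_set U X (\<lambda>n. {z \<in> X n. act n g z = z})"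
    using x by (auto simp: ultra_action_class act ultra_class_eq ultra_class_in_internal
        ultraproduct_def quotientI eventually_conj_iff Pi_iff)
qed auto

lemma essentially_free_loeb_iff:
  assumes count: "countable (carrier G)"
    and act: "\<And>g n z. g \<in> carrier G \<Longrightarrow> z \<in> X n \<Longrightarrow> act n g z \<in> X n"
  shows "essentially_free G (loeb_measure U X) (ultra_action U X act) \<longleftrightarrow>
     (\<forall>g\<in>carrier G - {\<one>\<^bsub>G\<^esub>}.
        ((\<lambda>n. real (card {z \<in> X n. act n g z = z}) / real (card (X n))) \<longlongrightarrow> 0) U)"
proof -
  have "(AE c in loeb_measure U X. ultra_action U X act g c \<noteq> c) \<longleftrightarrow>
      ((\<lambda>n. real (card {z \<in> X n. act n g z = z}) / real (card (X n))) \<longlongrightarrow> 0) U"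
    if g: "g \<in> carrier G" for g
  proof -
    let ?F = "\<lambda>n. {z \<in> X n. act n g z = z}"
    let ?r = "\<lambda>n. real (card (?F n)) / real (card (X n))"
    have sub: "\<And>n. ?F n \<subseteq> X n" by auto
    have lim: "(?r \<longlongrightarrow> Lim U ?r) U" by (rule ultra_density_tendsto[OF sub])
    have "0 \<le> Lim U ?r"
      by (rule tendsto_lowerbound[OF lim]) (auto simp: ultra_not_bot)
    have "{c \<in> space (loeb_measure U X). \<not> ultra_action U X act g c \<noteq> c} = internal_set U X ?F"
      using ultra_fixed_points[of act g] act g by (simp add: space_loeb)
    then have "(AE c in loeb_measure U X. ultra_action U X act g c \<noteq> c) \<longleftrightarrow>
        emeasure (loeb_measure U X) (internal_set U X ?F) = 0"
      by (intro AE_iff_measurable internal_in_sets_loeb sub)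
    also have "\<dots> \<longleftrightarrow> Lim U ?r = 0"
      using \<open>0 \<le> Lim U ?r\<close> by (simp add: emeasure_loeb_internal[OF sub])
    also have "\<dots> \<longleftrightarrow> (?r \<longlongrightarrow> 0) U"
      using lim tendsto_Lim[OF ultra_not_bot, of ?r 0] by auto
    finally show ?thesis .
  qed
  moreover have "countable (carrier G - {\<one>\<^bsub>G\<^esub>})" using count by blast
  ultimately show ?thesis unfolding essentially_free_def by (simp add: AE_ball_countable)
qed

end

end

lemma nonprincipal_ultrafilter_exists:
  assumes inf: "infinite S"
  shows "\<exists>U. nonprincipal_ultrafilter U \<and> (\<forall>\<^sub>F n in U. n \<in> S)"
proof -
  define F where "F = inf sequentially (principal S)"
  define A where "A = {G. G \<noteq> bot \<and> G \<le> F}"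
  have F: "F \<noteq> bot"
    using inf unfolding F_def trivial_limit_def eventually_inf_principal eventually_sequentially
      infinite_nat_iff_unbounded_le by auto
  have po: "partial_order_on A (relation_of (\<ge>) A)"
    by (auto simp: partial_order_on_def preorder_on_def refl_on_def trans_def antisym_def relation_of_def)
  have "\<exists>G\<in>A. \<forall>H\<in>C. G \<le> H" if C: "C \<in> Chains (relation_of (\<ge>) A)" for C
  proof (cases "C = {}")
    case True
    with F show ?thesis by (auto simp: A_def)
  next
    case False
    have CA: "C \<subseteq> A" and total: "\<And>G H. G \<in> C \<Longrightarrow> H \<in> C \<Longrightarrow> G \<le> H \<or> H \<le> G"
      using C unfolding Chains_def relation_of_def by blast+
    have "eventually P (Inf C) \<longleftrightarrow> (\<exists>G\<in>C. eventually P G)" for P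
      using False by (rule eventually_Inf_base) (use total in \<open>metis inf.absorb1 inf.absorb2 order_refl\<close>)
    then have "Inf C \<noteq> bot" using CA by (auto simp: trivial_limit_def A_def)
    moreover have "Inf C \<le> F" using False CA by (auto simp: A_def intro: Inf_lower2)
    ultimately show ?thesis by (auto simp: A_def intro!: bexI[of _ "Inf C"] Inf_lower)
  qed
  then obtain U where U: "U \<in> A" and max: "\<And>G. G \<in> A \<Longrightarrow> G \<le> U \<Longrightarrow> G = U"
    using predicate_Zorn[OF po] by auto
  have ultra: "eventually P U \<or> eventually (\<lambda>n. \<not> P n) U" for P
  proof (rule disjCI)
    let ?G = "inf U (principal {n. P n})"
    assume "\<not> eventually (\<lambda>n. \<not> P n) U"
    then have "?G \<noteq> bot" by (simp add: trivial_limit_def eventually_inf_principal)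
    then have "?G = U" using U by (intro max) (auto simp: A_def intro: le_infI1)
    moreover have "eventually P ?G" by (simp add: eventually_inf_principal)
    ultimately show "eventually P U" by simp
  qed
  have UF: "U \<le> F" "U \<noteq> bot" using U by (auto simp: A_def)
  have "U \<noteq> principal {k}" for k
  proof
    assume "U = principal {k}"
    moreover have "\<forall>\<^sub>F n in U. n \<ge> Suc k"
      by (rule filter_leD[OF UF(1)]) (auto simp: F_def eventually_inf_principal eventually_sequentially)
    ultimately show False by (simp add: eventually_principal)
  qed
  moreover have "\<forall>\<^sub>F n in U. n \<in> S"
    by (rule filter_leD[OF UF(1)]) (auto simp: F_def eventually_inf_principal)
  ultimately show ?thesis using ultra UF unfolding nonprincipal_ultrafilter_def by blast
qed

lemma sofic_approximation_iff:
  assumes fin: "\<And>n. finite (X n)" and ne: "\<And>n. X n \<noteq> {}"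
    and count: "countable (carrier G)"
    and act: "\<And>g n z. g \<in> carrier G \<Longrightarrow> z \<in> X n \<Longrightarrow> act n g z \<in> X n"
  shows "sofic_approximation G X act \<longleftrightarrow>
     (\<forall>g\<in>carrier G - {\<one>\<^bsub>G\<^esub>}.
        (\<lambda>n. real (card {z \<in> X n. act n g z = z}) / real (card (X n))) \<longlonglongrightarrow> 0)"
    (is "_ \<longleftrightarrow> (\<forall>g\<in>_. ?r g \<longlonglongrightarrow> 0)")
proof -
  have iff: "sofic_approximation G X act \<longleftrightarrow>
      (\<forall>U. nonprincipal_ultrafilter U \<longrightarrow> (\<forall>g\<in>carrier G - {\<one>\<^bsub>G\<^esub>}. (?r g \<longlongrightarrow> 0) U))"
    unfolding sofic_approximation_def using essentially_free_loeb_iff[OF _ fin ne count act] by auto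
  show ?thesis
  proof
    assume "\<forall>g\<in>carrier G - {\<one>\<^bsub>G\<^esub>}. ?r g \<longlonglongrightarrow> 0"
    then show "sofic_approximation G X act"
      unfolding iff using ultra_le_sequentially tendsto_mono by blast
  next
    assume sof: "sofic_approximation G X act"
    show "\<forall>g\<in>carrier G - {\<one>\<^bsub>G\<^esub>}. ?r g \<longlonglongrightarrow> 0"
    proof
      fix g assume g: "g \<in> carrier G - {\<one>\<^bsub>G\<^esub>}"
      show "?r g \<longlonglongrightarrow> 0"
      proof (rule topological_tendstoI, rule ccontr)
        fix V :: "real set"
        assume V: "open V" "0 \<in> V" and "\<not> (\<forall>\<^sub>F n in sequentially. ?r g n \<in> V)"
        then have "infinite {n. ?r g n \<notin> V}"
          by (auto simp: eventually_sequentially infinite_nat_iff_unbounded_le)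
        from nonprincipal_ultrafilter_exists[OF this]
        obtain U where U: "nonprincipal_ultrafilter U" and ev: "\<forall>\<^sub>F n in U. ?r g n \<notin> V"
          unfolding mem_Collect_eq by blast
        have "(?r g \<longlongrightarrow> 0) U" using sof U g unfolding iff by blast
        then have "\<forall>\<^sub>F n in U. ?r g n \<in> V" using V by (rule topological_tendstoD)
        then show False using ev ultra_not[OF U, of "\<lambda>n. ?r g n \<in> V"] by blast
      qed
    qed
  qed
qed


section \<open>Index and rank\<close>

text \<open>Only meaningful when the set of cosets is finite.\<close>
definition subgroup_index :: "('g, 'm) monoid_scheme \<Rightarrow> 'g set \<Rightarrow> nat" where
  "subgroup_index G H = card (lcosets\<^bsub>G\<^esub> H)"

definition finitely_generated :: "('g, 'm) monoid_scheme \<Rightarrow> bool" where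
  "finitely_generated G \<longleftrightarrow> (\<exists>S. finite S \<and> S \<subseteq> carrier G \<and> generate G S = carrier G)"

text \<open>The infimum is \<open>\<infinity>\<close> if there is no finite generating set.\<close>
definition group_rank :: "('g, 'm) monoid_scheme \<Rightarrow> enat" where
  "group_rank G = Inf {enat (card S) | S. finite S \<and> S \<subseteq> carrier G \<and> generate G S = carrier G}"


section \<open>The group \<open>\<Lambda> \<ltimes> \<int>\<^sup>2\<close>\<close>

definition SL2Z :: "(int^2^2) monoid" where
  "SL2Z = \<lparr>carrier = {A. det A = 1}, mult = (**), one = mat 1\<rparr>"

definition hyperbolic :: "int^2^2 \<Rightarrow> bool" where
  "hyperbolic A \<longleftrightarrow> \<bar>trace A\<bar> > 2"

text \<open>The pair \<open>(A, v)\<close> corresponds to the affine map \<open>x \<mapsto> A x + v\<close>.\<close>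
definition semidirect_Z2 :: "(int^2^2) set \<Rightarrow> ((int^2^2) \<times> (int^2)) monoid" where
  "semidirect_Z2 \<Lambda> =
     \<lparr>carrier = \<Lambda> \<times> UNIV,
      mult = (\<lambda>(A, v) (B, w). (A ** B, v + A *v w)),
      one = (mat 1, 0)\<rparr>"

definition translation_subgroup :: "((int^2^2) \<times> (int^2)) set" where
  "translation_subgroup = {mat 1} \<times> UNIV"

lemma group_SL2Z: "group SL2Z"
proof (rule groupI)
  fix A assume "A \<in> carrier SL2Z"
  then have d: "det A = 1" by (simp add: SL2Z_def)
  let ?B = "\<chi> i j. if i = 1 then (if j = 1 then A$2$2 else - (A$1$2))
                    else (if j = 1 then - (A$2$1) else A$1$1) :: int^2^2"
  have "?B ** A = mat 1" "det ?B = 1"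
    using d by (auto simp: det_2 matrix_matrix_mult_def sum_2 vec_eq_iff mat_def forall_2 algebra_simps)
  then show "\<exists>B\<in>carrier SL2Z. B \<otimes>\<^bsub>SL2Z\<^esub> A = \<one>\<^bsub>SL2Z\<^esub>"
    by (intro bexI[of _ ?B]) (auto simp: SL2Z_def)
qed (auto simp: SL2Z_def det_mul matrix_mul_assoc)

lemma group_semidirect_Z2:
  assumes "subgroup \<Lambda> SL2Z"
  shows "group (semidirect_Z2 \<Lambda>)"
proof -
  interpret S: group SL2Z by (rule group_SL2Z)
  interpret subgroup \<Lambda> SL2Z by fact
  show ?thesis
  proof (rule groupI)
    fix p assume "p \<in> carrier (semidirect_Z2 \<Lambda>)"
    then obtain A v where p: "p = (A, v)" and A: "A \<in> \<Lambda>"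
      by (auto simp: semidirect_Z2_def)
    define B where "B = inv\<^bsub>SL2Z\<^esub> A"
    have "B \<otimes>\<^bsub>SL2Z\<^esub> A = \<one>\<^bsub>SL2Z\<^esub>"
      using A unfolding B_def by simp
    then have B: "B \<in> \<Lambda>" "B ** A = mat 1"
      using A m_inv_closed unfolding B_def by (simp_all add: SL2Z_def)
    show "\<exists>q\<in>carrier (semidirect_Z2 \<Lambda>). q \<otimes>\<^bsub>semidirect_Z2 \<Lambda>\<^esub> p = \<one>\<^bsub>semidirect_Z2 \<Lambda>\<^esub>"
      by (rule bexI[of _ "(B, - (B *v v))"]) (auto simp: semidirect_Z2_def B p)
  next
    show "\<one>\<^bsub>semidirect_Z2 \<Lambda>\<^esub> \<in> carrier (semidirect_Z2 \<Lambda>)"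
      using one_closed by (simp add: semidirect_Z2_def SL2Z_def)
  next
    fix x y assume "x \<in> carrier (semidirect_Z2 \<Lambda>)" "y \<in> carrier (semidirect_Z2 \<Lambda>)"
    then show "x \<otimes>\<^bsub>semidirect_Z2 \<Lambda>\<^esub> y \<in> carrier (semidirect_Z2 \<Lambda>)"
      using m_closed by (auto simp: semidirect_Z2_def SL2Z_def)
  qed (auto simp: semidirect_Z2_def matrix_mul_assoc matrix_vector_mul_assoc
         matrix_vector_right_distrib add.assoc)
qed

lemma subgroup_translation_subgroup:
  assumes "subgroup \<Lambda> SL2Z"
  shows "subgroup translation_subgroup (semidirect_Z2 \<Lambda>)"
proof -
  interpret G: group "semidirect_Z2 \<Lambda>" by (rule group_semidirect_Z2) fact
  have one: "mat 1 \<in> \<Lambda>"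
    using subgroup.one_closed[OF assms] by (simp add: SL2Z_def)
  show ?thesis
  proof (rule G.subgroupI)
    fix p assume "p \<in> translation_subgroup"
    then obtain v where p: "p = (mat 1, v)" by (auto simp: translation_subgroup_def)
    have "inv\<^bsub>semidirect_Z2 \<Lambda>\<^esub> p = (mat 1, - v)"
      by (rule G.inv_equality) (auto simp: p semidirect_Z2_def one)
    then show "inv\<^bsub>semidirect_Z2 \<Lambda>\<^esub> p \<in> translation_subgroup" by (simp add: translation_subgroup_def)
  qed (auto simp: translation_subgroup_def semidirect_Z2_def one)
qed

end

theory Submission
  imports Defs
begin

text \<open>
  Soficity.  If \<open>\<gamma>\<close> has infinitely many conjugates \<open>g\<^sub>i \<gamma> g\<^sub>i\<inverse>\<close> such that any two of them have few common fixed
  points, then \<open>\<gamma>\<close> has few fixed points, because all conjugates have equally many.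
  For a translation by \<open>v \<noteq> 0\<close> take the powers \<open>g\<^sub>i = h\<^sup>i\<close> of a hyperbolic element:
  a common fixed point of the translations by \<open>h\<^sup>i v\<close> and \<open>h\<^sup>j v\<close> forces \<open>\<Gamma>\<^sub>n\<close> to contain
  \<open>d \<int>\<^sup>2\<close> with \<open>d = h\<^sup>i v \<and> h\<^sup>j v \<noteq> 0\<close>, which bounds the index of \<open>\<Gamma>\<^sub>n \<inter> \<int>\<^sup>2\<close>.
  For \<open>\<gamma> = (A, v)\<close> with \<open>A u \<noteq> u\<close> take the translations \<open>g\<^sub>i\<close> by \<open>i u\<close>: a common fixed point of two
  conjugates is fixed by a translation by a nonzero multiple of \<open>A u - u\<close>, and the first case applies.

  Rank.  Let \<open>k\<close> be the index of \<open>\<Gamma>\<^sub>n \<int>\<^sup>2\<close>.  Then \<open>\<Gamma>\<^sub>n / (\<Gamma>\<^sub>n \<inter> \<int>\<^sup>2)\<close> has rank at most \<open>k rank(\<Gamma>)\<close> by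
  Schreier's lemma, \<open>\<Gamma>\<^sub>n \<inter> \<int>\<^sup>2\<close> has rank at most \<open>2\<close>, and \<open>[\<Gamma> : \<Gamma>\<^sub>n] \<ge> k [\<int>\<^sup>2 : \<Gamma>\<^sub>n \<inter> \<int>\<^sup>2]\<close>.
\<close>


section \<open>Densities\<close>

text \<open>Second Bonferroni inequality, rearranged so that no subtraction occurs. In the induction
  the new set meets the union of the earlier ones in at most the sum of its pairwise
  intersections.\<close>

lemma card_UN_ge_Bonferroni:
  fixes A :: "nat \<Rightarrow> 'a set"
  assumes "\<And>i. finite (A i)"
  shows "(\<Sum>i<M. real (card (A i)))
    \<le> real (card (\<Union>i<M. A i)) + (\<Sum>j<M. \<Sum>i<j. real (card (A i \<inter> A j)))"
proof (induction M)
  case (Suc M)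
  let ?U = "\<Union>i<M. A i"
  have fin: "finite ?U" using assms by auto
  have "card (?U \<inter> A M) = card (\<Union>i<M. A i \<inter> A M)" by (simp add: Int_UN_distrib2 Int_commute)
  also have "\<dots> \<le> (\<Sum>i<M. card (A i \<inter> A M))" by (rule card_UN_le) simp
  finally have le: "real (card (?U \<inter> A M)) \<le> (\<Sum>i<M. real (card (A i \<inter> A M)))"
    by (metis of_nat_le_iff of_nat_sum)
  have "card ?U + card (A M) = card (?U \<union> A M) + card (?U \<inter> A M)"
    by (rule card_Un_Int[OF fin assms])
  then have "real (card ?U) + real (card (A M)) = real (card (?U \<union> A M)) + real (card (?U \<inter> A M))"
    by linarith
  moreover have "(\<Union>i<Suc M. A i) = ?U \<union> A M" by (auto simp: less_Suc_eq)
  ultimately show ?case using Suc le by simp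
qed simp

text \<open>The first \<open>M\<close> sets \<open>A i n\<close> are each at least as large as
  \<open>F n\<close>, fit into \<open>X n\<close>, and overlap in a vanishing proportion. So
  \<open>M\<close> times the density of \<open>F n\<close> is at most 1 plus a null sequence, for
  every \<open>M\<close>.\<close>

lemma density_tendsto_0_if_almost_disjoint:
  fixes X F :: "nat \<Rightarrow> 'a set" and A :: "nat \<Rightarrow> nat \<Rightarrow> 'a set"
  assumes fin: "\<And>n. finite (X n)" and sub: "\<And>i n. A i n \<subseteq> X n"
    and le: "\<And>i n. card (F n) \<le> card (A i n)"
    and disj: "\<And>i j. i < j \<Longrightarrow>
      (\<lambda>n. real (card (A i n \<inter> A j n)) / real (card (X n))) \<longlonglongrightarrow> 0"
  shows "(\<lambda>n. real (card (F n)) / real (card (X n))) \<longlonglongrightarrow> 0"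
proof (rule LIMSEQ_I)
  fix e :: real assume e: "0 < e"
  \<comment> \<open>The 2 is the total density 1 plus the overlap \<open>\<delta> n\<close>, which
    is eventually below 1.\<close>
  define M where "M = nat \<lceil>2 / e\<rceil>"
  have M: "2 / e \<le> real M" unfolding M_def by linarith
  then have M0: "0 < real M" using e by (smt (verit) divide_pos_pos)
  define \<delta> where "\<delta> n = (\<Sum>j<M. \<Sum>i<j. real (card (A i n \<inter> A j n)) / real (card (X n)))" for n
  have "\<delta> \<longlonglongrightarrow> (\<Sum>j<M. \<Sum>i<j. 0)"
    unfolding \<delta>_def by (intro tendsto_sum disj) simp
  then have "\<delta> \<longlonglongrightarrow> 0" by simp
  from LIMSEQ_D[OF this, of 1]
  obtain n0 where n0: "\<And>n. n \<ge> n0 \<Longrightarrow> \<bar>\<delta> n\<bar> < 1" by auto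
  show "\<exists>n0. \<forall>n\<ge>n0. norm (real (card (F n)) / real (card (X n)) - 0) < e"
  proof (intro exI[of _ n0] allI impI)
    fix n assume "n \<ge> n0"
    then have d: "\<delta> n < 1" using n0 by fastforce
    have finA: "finite (A i n)" for i using sub fin finite_subset by blast
    show "norm (real (card (F n)) / real (card (X n)) - 0) < e"
    \<comment> \<open>If \<open>X n\<close> is empty, the quotient is 0 by division by zero.\<close>
    proof (cases "card (X n) = 0")
      case False
      then have X: "0 < real (card (X n))" by simp
      have "real M * real (card (F n)) = (\<Sum>i<M. real (card (F n)))" by simp
      also have "\<dots> \<le> (\<Sum>i<M. real (card (A i n)))" by (intro sum_mono) (use le in simp)
      also have "\<dots> \<le> real (card (\<Union>i<M. A i n)) + (\<Sum>j<M. \<Sum>i<j. real (card (A i n \<inter> A j n)))"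
        by (rule card_UN_ge_Bonferroni) (rule finA)
      also have "(\<Sum>j<M. \<Sum>i<j. real (card (A i n \<inter> A j n))) = \<delta> n * real (card (X n))"
        using X by (simp add: \<delta>_def sum_distrib_right)
      also have "card (\<Union>i<M. A i n) \<le> card (X n)"
        by (rule card_mono[OF fin]) (use sub in blast)
      finally have "real M * real (card (F n)) \<le> real (card (X n)) + \<delta> n * real (card (X n))" by simp
      also have "\<dots> < 2 * real (card (X n))" using d X by simp
      finally have "real M * (real (card (F n)) / real (card (X n))) < 2"
        using X by (simp add: field_simps)
      also have "2 \<le> real M * e" using M e by (simp add: field_simps)
      finally have "real (card (F n)) / real (card (X n)) < e"
        using M0 by (simp only: mult_less_cancel_left_pos)
      then show ?thesis by simp
    qed (use e in simp)
  qed
qed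


section \<open>Left cosets and Schreier's lemma\<close>

context group
begin

lemma l_coset_eq_iff:
  assumes "subgroup H G" "a \<in> carrier G" "b \<in> carrier G"
  shows "a <# H = b <# H \<longleftrightarrow> inv a \<otimes> b \<in> H"
proof
  assume "a <# H = b <# H"
  then have "b \<in> a <# H" using lcos_self[OF assms(3,1)] by simp
  then show "inv a \<otimes> b \<in> H" using subgroup.lcos_module_imp[OF assms(1) is_group assms(2)] by simp
next
  assume "inv a \<otimes> b \<in> H"
  then have "b \<in> a <# H" using subgroup.lcos_module_rev[OF assms(1) is_group assms(2,3)] by simp
  then show "a <# H = b <# H" using l_repr_independence[OF _ assms(2,1)] by simp
qed

lemma l_coset_in_lcosets: "a \<in> carrier G \<Longrightarrow> a <# H \<in> lcosets H"
  by (auto simp: LCOSETS_def)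

lemma l_coset_translate_in_lcosets:
  assumes "subgroup H G" "C \<in> lcosets H" "g \<in> carrier G"
  shows "g <# C \<in> lcosets H"
  using assms by (auto simp: LCOSETS_def lcos_m_assoc subgroup.subset)

text \<open>Left translation by \<open>g i\<close> is injective on cosets and carries those fixed by
  \<open>a\<close> to those fixed by the conjugate of \<open>a\<close> by \<open>g i\<close>. The
  fixed-point sets of the conjugates are therefore large enough to serve as the almost disjoint
  sets.\<close>

lemma lcosets_fixed_density_tendsto_0:
  fixes N :: "nat \<Rightarrow> 'a set" and g :: "nat \<Rightarrow> 'a"
  assumes N: "\<And>n. subgroup (N n) G" and fin: "\<And>n. finite (lcosets (N n))"
    and a: "a \<in> carrier G" and g: "\<And>i. g i \<in> carrier G"
    and disj: "\<And>i j. i < j \<Longrightarrow>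
      (\<lambda>n. real (card {C \<in> lcosets (N n). (g i \<otimes> a \<otimes> inv (g i)) <# C = C
            \<and> (g j \<otimes> a \<otimes> inv (g j)) <# C = C}) / real (card (lcosets (N n)))) \<longlonglongrightarrow> 0"
  shows "(\<lambda>n. real (card {C \<in> lcosets (N n). a <# C = C}) / real (card (lcosets (N n)))) \<longlonglongrightarrow> 0"
proof (rule density_tendsto_0_if_almost_disjoint[OF fin])
  let ?A = "\<lambda>i n. {C \<in> lcosets (N n). (g i \<otimes> a \<otimes> inv (g i)) <# C = C}"
  show "?A i n \<subseteq> lcosets (N n)" for i n by blast
  show "(\<lambda>n. real (card (?A i n \<inter> ?A j n)) / real (card (lcosets (N n)))) \<longlonglongrightarrow> 0" if "i < j" for i j
  proof -
    have "?A i n \<inter> ?A j n = {C \<in> lcosets (N n). (g i \<otimes> a \<otimes> inv (g i)) <# C = C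
            \<and> (g j \<otimes> a \<otimes> inv (g j)) <# C = C}" for n by blast
    then show ?thesis using disj[OF that] by simp
  qed
  show "card {C \<in> lcosets (N n). a <# C = C} \<le> card (?A i n)" for i n
  proof (rule card_inj_on_le)
    have sub: "C \<subseteq> carrier G" if "C \<in> lcosets (N n)" for C
      using subgroup.lcosets_carrier[OF N is_group that] .
    show "inj_on (\<lambda>C. g i <# C) {C \<in> lcosets (N n). a <# C = C}"
    proof (rule inj_on_inverseI)
      fix C assume "C \<in> {C \<in> lcosets (N n). a <# C = C}"
      then show "inv (g i) <# (g i <# C) = C"
        using sub g by (simp add: lcos_m_assoc lcos_mult_one)
    qed
    show "(\<lambda>C. g i <# C) ` {C \<in> lcosets (N n). a <# C = C} \<subseteq> ?A i n"
    proof clarify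
      fix C assume C: "C \<in> lcosets (N n)" "a <# C = C"
      have "(g i \<otimes> a \<otimes> inv (g i)) <# (g i <# C) = (g i \<otimes> a \<otimes> inv (g i) \<otimes> g i) <# C"
        using sub[OF C(1)] g a by (simp add: lcos_m_assoc)
      also have "g i \<otimes> a \<otimes> inv (g i) \<otimes> g i = g i \<otimes> a" using g a by (simp add: m_assoc)
      also have "(g i \<otimes> a) <# C = g i <# C" using lcos_m_assoc[OF sub[OF C(1)] g a] C(2) by simp
      finally show "g i <# C \<in> lcosets (N n) \<and> (g i \<otimes> a \<otimes> inv (g i)) <# (g i <# C) = g i <# C"
        using l_coset_translate_in_lcosets[OF N C(1) g] by simp
    qed
    show "finite (?A i n)" using fin by simp
  qed
qed

section \<open>Generators of finite-index subgroups\<close>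

text \<open>Schreier's lemma in its left-coset form: with a transversal \<open>R\<close> and
  representative map \<open>t\<close>, the elements
  \<open>inv (t (s \<otimes> r)) \<otimes> (s \<otimes> r)\<close> generate \<open>H\<close>, and
  there is at most one for each pair in \<open>R \<times> S\<close>.\<close>

lemma Schreier_generators:
  assumes H: "subgroup H G" and fin: "finite (lcosets H)"
    and S: "finite S" "S \<subseteq> carrier G" "generate G S = carrier G"
  shows "\<exists>T\<subseteq>H. finite T \<and> card T \<le> card (lcosets H) * card S \<and> generate G T = H"
proof -
  \<comment> \<open>The coset \<open>H\<close> itself is represented by \<open>\<one>\<close>. Hence
    \<open>key\<close> below, applied to an element \<open>h\<close> of \<open>H\<close> with
    \<open>r = \<one>\<close>, puts \<open>h\<close> itself into the generated subgroup.\<close>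
  define t where "t g = (if g \<in> H then \<one> else SOME r. r \<in> carrier G \<and> r <# H = g <# H)" for g
  have t_car: "t g \<in> carrier G" and t_cos: "t g <# H = g <# H" if g: "g \<in> carrier G" for g
  proof -
    have "t g \<in> carrier G \<and> t g <# H = g <# H"
    proof (cases "g \<in> H")
      case True
      then show ?thesis using g by (simp add: t_def l_coset_eq_iff[OF H])
    next
      case False
      then show ?thesis unfolding t_def using someI[of "\<lambda>r. r \<in> carrier G \<and> r <# H = g <# H" g] g by simp
    qed
    then show "t g \<in> carrier G" "t g <# H = g <# H" by auto
  qed
  have t_cong: "t g = t g'" if "g \<in> carrier G" "g' \<in> carrier G" "g <# H = g' <# H" for g g'
  proof -
    have "g \<in> H \<longleftrightarrow> g' \<in> H"
      using that l_coset_eq_iff[OF H, of \<one>] by (metis inv_one l_one one_closed)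
    then show ?thesis using that by (simp add: t_def)
  qed
  have t_t: "t (t g) = t g" if "g \<in> carrier G" for g
    using t_cong[OF t_car[OF that] that t_cos[OF that]] .
  define R where "R = t ` carrier G"
  have R_car: "R \<subseteq> carrier G" using t_car by (auto simp: R_def)
  have t_R: "t r = r" if "r \<in> R" for r using that t_t by (auto simp: R_def)
  have R_inj: "inj_on (\<lambda>r. r <# H) R"
    by (rule inj_onI) (metis R_car subsetD t_R t_cong)
  have R_img: "(\<lambda>r. r <# H) ` R \<subseteq> lcosets H"
    using R_car l_coset_in_lcosets by blast
  have R_fin: "finite R" using finite_imageD[OF finite_subset[OF R_img fin] R_inj] .
  have R_card: "card R \<le> card (lcosets H)" by (rule card_inj_on_le[OF R_inj R_img fin])
  define f where "f = (\<lambda>(r, s). inv (t (s \<otimes> r)) \<otimes> (s \<otimes> r))"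
  define T where "T = f ` (R \<times> S)"
  have TH: "T \<subseteq> H"
  proof -
    have "inv (t (s \<otimes> r)) \<otimes> (s \<otimes> r) \<in> H" if "r \<in> R" "s \<in> S" for r s
    proof -
      have "s \<otimes> r \<in> carrier G" using that R_car S(2) by auto
      then show ?thesis using l_coset_eq_iff[OF H] t_car t_cos by blast
    qed
    then show ?thesis by (auto simp: T_def f_def)
  qed
  have T_car: "T \<subseteq> carrier G" using TH subgroup.subset[OF H] by blast
  have "card T \<le> card (R \<times> S)" unfolding T_def by (rule card_image_le) (use R_fin S in simp)
  also have "\<dots> \<le> card (lcosets H) * card S" using R_card by (simp add: card_cartesian_product)
  finally have T_card: "card T \<le> card (lcosets H) * card S" .
  interpret K: subgroup "generate G T" G by (rule generate_is_subgroup[OF T_car])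
  \<comment> \<open>The statement concerns all representatives \<open>r\<close> at once, because
    multiplying by one letter moves the representative.\<close>
  have key: "inv (t (g \<otimes> r)) \<otimes> (g \<otimes> r) \<in> generate G T" if "g \<in> generate G S" "r \<in> R" for g r
    using that
  proof (induction g arbitrary: r rule: generate.induct)
    case one
    then have "r \<in> carrier G" using R_car by blast
    then show ?case using one t_R by simp
  next
    case (incl s)
    then show ?case by (intro generate.incl) (auto simp: T_def f_def)
  next
    case (inv s)
    have s: "s \<in> carrier G" and r: "r \<in> carrier G" using inv S R_car by auto
    \<comment> \<open>Since \<open>s \<otimes> r'\<close> lies in the coset of \<open>r\<close>, its
      representative is \<open>r\<close>. The required element is thus the inverse of the Schreier
      generator for \<open>(r', s)\<close>.\<close>
    define r' where "r' = t (inv s \<otimes> r)"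
    have r': "r' \<in> R" "r' \<in> carrier G" using s r t_car by (auto simp: R_def r'_def)
    have "inv r' \<otimes> (inv s \<otimes> r) \<in> H"
      using l_coset_eq_iff[OF H, of r' "inv s \<otimes> r"] t_cos[of "inv s \<otimes> r"] r' s r by (simp add: r'_def)
    then have "inv (s \<otimes> r') \<otimes> r \<in> H" using s r r' by (simp add: inv_mult_group m_assoc)
    then have "t (s \<otimes> r') = t r"
      using l_coset_eq_iff[OF H] s r r' by (intro t_cong) auto
    then have "t (s \<otimes> r') = r" using t_R inv by simp
    then have "inv r \<otimes> (s \<otimes> r') \<in> T" using inv r' by (force simp: T_def f_def)
    then have "inv (inv r \<otimes> (s \<otimes> r')) \<in> generate G T" by (rule generate.inv)
    also have "inv (inv r \<otimes> (s \<otimes> r')) = inv r' \<otimes> (inv s \<otimes> r)"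
      using s r r' by (simp add: inv_mult_group m_assoc)
    finally show ?case by (simp add: r'_def)
  next
    case (eng g1 g2)
    have g: "g1 \<in> carrier G" "g2 \<in> carrier G" "r \<in> carrier G"
      using eng generate_in_carrier[OF S(2)] R_car by auto
    \<comment> \<open>Telescoping: the element for \<open>(g1, r2)\<close> times the one for
      \<open>(g2, r)\<close> is the element for \<open>(g1 \<otimes> g2, r)\<close>, as
      \<open>r2\<close> cancels.\<close>
    define r2 where "r2 = t (g2 \<otimes> r)"
    have r2: "r2 \<in> R" "r2 \<in> carrier G" using g t_car by (auto simp: R_def r2_def)
    have mem: "inv r2 \<otimes> (g2 \<otimes> r) \<in> generate G T" using eng.IH(2)[OF eng.prems] by (simp add: r2_def)
    have "inv (g1 \<otimes> r2) \<otimes> (g1 \<otimes> (g2 \<otimes> r)) = inv r2 \<otimes> (g2 \<otimes> r)"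
      using g r2 by (simp add: inv_mult_group m_assoc inv_solve_left')
    then have eq: "t (g1 \<otimes> r2) = t (g1 \<otimes> g2 \<otimes> r)"
      using l_coset_eq_iff[OF H] t_cos[of "g2 \<otimes> r"] g r2
      by (intro t_cong) (auto simp: m_assoc r2_def)
    define w where "w = t (g1 \<otimes> g2 \<otimes> r)"
    have w: "w \<in> carrier G" using g t_car by (simp add: w_def)
    have "inv w \<otimes> (g1 \<otimes> r2) \<in> generate G T" using eng.IH(1)[OF r2(1)] eq by (simp add: w_def)
    then have "(inv w \<otimes> (g1 \<otimes> r2)) \<otimes> (inv r2 \<otimes> (g2 \<otimes> r)) \<in> generate G T"
      using mem by (rule generate.eng)
    also have "(inv w \<otimes> (g1 \<otimes> r2)) \<otimes> (inv r2 \<otimes> (g2 \<otimes> r)) = inv w \<otimes> (g1 \<otimes> g2 \<otimes> r)"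
    proof -
      have "r2 \<otimes> (inv r2 \<otimes> (g2 \<otimes> r)) = g2 \<otimes> r" using g r2 by (simp add: m_assoc[symmetric])
      then show ?thesis using g r2 w by (simp add: m_assoc)
    qed
    finally show ?case by (simp add: w_def)
  qed
  have t1: "t \<one> = \<one>" using subgroup.one_closed[OF H] by (simp add: t_def)
  have "H \<subseteq> generate G T"
  proof
    fix h assume h: "h \<in> H"
    then have hc: "h \<in> carrier G" using subgroup.mem_carrier[OF H] by blast
    have "\<one> \<in> R" using t1 by (force simp: R_def)
    then have "inv (t h) \<otimes> h \<in> generate G T" using key[of h \<one>] hc S(3) by simp
    then show "h \<in> generate G T" using h hc by (simp add: t_def)
  qed
  moreover have "generate G T \<subseteq> H" by (rule generate_subgroup_incl[OF TH H])
  ultimately show ?thesis using TH T_card R_fin S(1) by (intro exI[of _ T]) (auto simp: T_def)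
qed

section \<open>Comparison of indices\<close>

text \<open>The map from \<open>C\<close> to \<open>C <#> K\<close> sends the cosets of
  \<open>N\<close> onto those of \<open>K\<close>, since \<open>N <#> K = K\<close>.\<close>

lemma lcosets_subset_finite:
  assumes N: "subgroup N G" and K: "subgroup K G" and NK: "N \<subseteq> K" and fin: "finite (lcosets N)"
  shows "finite (lcosets K)"
proof -
  have "lcosets K \<subseteq> (\<lambda>C. C <#> K) ` (lcosets N)"
  proof
    fix D assume "D \<in> lcosets K"
    then obtain a where a: "a \<in> carrier G" "D = a <# K" by (auto simp: LCOSETS_def)
    have "N <#> K = K"
    proof
      show "N <#> K \<subseteq> K" using NK subgroup.m_closed[OF K] by (auto simp: set_mult_def)
      show "K \<subseteq> N <#> K"
        using subgroup.one_closed[OF N] subgroup.mem_carrier[OF K] by (force simp: set_mult_def)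
    qed
    then have "D = (a <# N) <#> K"
      using a setmult_lcos_assoc[of N K a] subgroup.subset[OF N] subgroup.subset[OF K] by simp
    then show "D \<in> (\<lambda>C. C <#> K) ` (lcosets N)" using a l_coset_in_lcosets by blast
  qed
  then show ?thesis using fin finite_surj by blast
qed

text \<open>This combines [G : N] = [G : K] [K : N] with the embedding of P/(N \<inter> P) into K/N.
  Both are done by one injection, which multiplies a representative of a coset of \<open>K\<close>
  by a representative of a coset of \<open>N \<inter> P\<close> in \<open>P\<close>.\<close>

lemma card_lcosets_mult_le:
  assumes N: "subgroup N G" and K: "subgroup K G" and P: "subgroup P G"
    and NK: "N \<subseteq> K" and PK: "P \<subseteq> K" and fin: "finite (lcosets N)"
  shows "card (lcosets K) * card (lcosets\<^bsub>G\<lparr>carrier := P\<rparr>\<^esub> (N \<inter> P)) \<le> card (lcosets N)"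
proof -
  interpret N: subgroup N G by fact
  interpret K: subgroup K G by fact
  interpret P: subgroup P G by fact
  have NP: "subgroup (N \<inter> P) G" by (rule subgroups_Inter_pair[OF N P])
  define r where "r C = (SOME a. a \<in> carrier G \<and> C = a <# K)" for C
  have r: "r C \<in> carrier G" "C = r C <# K" if "C \<in> lcosets K" for C
    using someI_ex[of "\<lambda>a. a \<in> carrier G \<and> C = a <# K"] that by (auto simp: LCOSETS_def r_def)
  define p where "p D = (SOME a. a \<in> P \<and> D = a <# (N \<inter> P))" for D
  have p: "p D \<in> P" "D = p D <# (N \<inter> P)" if "D \<in> lcosets\<^bsub>G\<lparr>carrier := P\<rparr>\<^esub> (N \<inter> P)" for D
    using someI_ex[of "\<lambda>a. a \<in> P \<and> D = a <# (N \<inter> P)"] that by (auto simp: LCOSETS_def p_def)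
  let ?L = "(lcosets K) \<times> (lcosets\<^bsub>G\<lparr>carrier := P\<rparr>\<^esub> (N \<inter> P))"
  let ?f = "\<lambda>(C, D). (r C \<otimes> p D) <# N"
  have "inj_on ?f ?L"
  proof (rule inj_onI, clarsimp)
    fix C D C' D'
    assume C: "C \<in> lcosets K" "C' \<in> lcosets K"
      and D: "D \<in> lcosets\<^bsub>G\<lparr>carrier := P\<rparr>\<^esub> (N \<inter> P)" "D' \<in> lcosets\<^bsub>G\<lparr>carrier := P\<rparr>\<^esub> (N \<inter> P)"
      and eq: "(r C \<otimes> p D) <# N = (r C' \<otimes> p D') <# N"
    note rr = r(1)[OF C(1)] r(1)[OF C(2)]
    note pp = p(1)[OF D(1)] p(1)[OF D(2)]
    have pc: "p D \<in> carrier G" "p D' \<in> carrier G" using pp by auto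
    have n: "inv (r C \<otimes> p D) \<otimes> (r C' \<otimes> p D') \<in> N"
      using eq l_coset_eq_iff[OF N] rr pc by simp
    \<comment> \<open>All factors lie in \<open>K\<close>, and the product collapses to
      \<open>inv (r C) \<otimes> r C'\<close>. So the cosets of \<open>K\<close> agree first; then
      \<open>r C\<close> cancels and those of \<open>N \<inter> P\<close> are compared.\<close>
    have "p D \<otimes> (inv (r C \<otimes> p D) \<otimes> (r C' \<otimes> p D')) \<otimes> inv (p D') \<in> K"
      using n NK PK pp by (meson K.m_closed K.m_inv_closed subsetD)
    also have "p D \<otimes> (inv (r C \<otimes> p D) \<otimes> (r C' \<otimes> p D')) \<otimes> inv (p D') = inv (r C) \<otimes> r C'"
      using rr pc by (simp add: inv_mult_group m_assoc) (simp add: m_assoc[symmetric])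
    finally have "r C <# K = r C' <# K" using l_coset_eq_iff[OF K] rr by simp
    then have CC: "C = C'" using r(2) C by simp
    have "inv (r C \<otimes> p D) \<otimes> (r C' \<otimes> p D') = inv (p D) \<otimes> p D'"
      using rr pc CC by (simp add: inv_mult_group m_assoc inv_solve_left')
    then have "inv (p D) \<otimes> p D' \<in> N \<inter> P" using n pp by simp
    then have "p D <# (N \<inter> P) = p D' <# (N \<inter> P)" using l_coset_eq_iff[OF NP] pc by simp
    then show "C = C' \<and> D = D'" using CC p(2) D by simp
  qed
  moreover have "?f ` ?L \<subseteq> lcosets N"
    using r(1) p(1) by (auto intro!: l_coset_in_lcosets)
  ultimately have "card ?L \<le> card (lcosets N)" using fin by (rule card_inj_on_le)
  then show ?thesis by (simp add: card_cartesian_product)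
qed

end


section \<open>Arithmetic of \<open>\<int>\<^sup>2\<close>\<close>

text \<open>Division with remainder by the least positive element, unless the set is
  \<open>{0}\<close>.\<close>

lemma int_set_diff_closed_principal:
  fixes I :: "int set"
  assumes zero: "0 \<in> I" and diff: "\<And>x y. x \<in> I \<Longrightarrow> y \<in> I \<Longrightarrow> x - y \<in> I"
  shows "\<exists>d\<in>I. \<forall>x\<in>I. d dvd x"
proof (cases "I \<subseteq> {0}")
  case True
  then show ?thesis using zero by auto
next
  case False
  have neg: "- x \<in> I" if "x \<in> I" for x using diff[OF zero that] by simp
  have add: "x + y \<in> I" if "x \<in> I" "y \<in> I" for x y using diff[OF that(1) neg[OF that(2)]] by simp
  have mult: "k * x \<in> I" if "x \<in> I" for k x :: int
  proof (induction k rule: int_induct[where k = 0])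
    case (step1 i)
    then show ?case using add[OF step1(2) that] by (simp add: algebra_simps)
  next
    case (step2 i)
    then show ?case using diff[OF step2(2) that] by (simp add: algebra_simps)
  qed (use zero in simp)
  obtain x where "x \<in> I" "x \<noteq> 0" using False by blast
  then have "\<exists>n::nat. n > 0 \<and> int n \<in> I"
    using neg[of x] by (intro exI[of _ "nat \<bar>x\<bar>"]) (auto simp: abs_if)
  then obtain n :: nat where n: "n > 0" "int n \<in> I"
    and least: "\<And>m. m < n \<Longrightarrow> \<not> (m > 0 \<and> int m \<in> I)"
    using exists_least_iff[of "\<lambda>n. n > 0 \<and> int n \<in> I"] by blast
  have "int n dvd x" if x: "x \<in> I" for x
  proof -
    have "x mod int n = x - (x div int n) * int n" by (simp add: minus_div_mult_eq_mod)
    then have "x mod int n \<in> I" using diff[OF x mult[OF n(2)]] by simp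
    moreover have "0 \<le> x mod int n" "x mod int n < int n" using n by auto
    ultimately have "x mod int n = 0"
      using least[of "nat (x mod int n)"] by (cases "x mod int n = 0") (auto simp: nat_less_iff)
    then show ?thesis by auto
  qed
  then show ?thesis using n by blast
qed

text \<open>Triangular basis: the first coordinate of \<open>a\<close> generates all first
  coordinates occurring in \<open>V\<close>, and \<open>b\<close> generates the elements of
  \<open>V\<close> with first coordinate 0. Either vector may be 0.\<close>

lemma int2_set_diff_closed_two_generators:
  fixes V :: "(int^2) set"
  assumes zero: "0 \<in> V" and diff: "\<And>x y. x \<in> V \<Longrightarrow> y \<in> V \<Longrightarrow> x - y \<in> V"
    and mult: "\<And>k x. x \<in> V \<Longrightarrow> k *s x \<in> V"
  shows "\<exists>a\<in>V. \<exists>b\<in>V. \<forall>x\<in>V. \<exists>m n. x = m *s a + n *s b"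
proof -
  have "\<exists>d\<in>(\<lambda>x. x$1) ` V. \<forall>x\<in>(\<lambda>x. x$1) ` V. d dvd x"
  proof (rule int_set_diff_closed_principal)
    show "0 \<in> (\<lambda>x. x$1) ` V" using zero by force
    fix x y assume "x \<in> (\<lambda>x. x$1) ` V" "y \<in> (\<lambda>x. x$1) ` V"
    then obtain x' y' where "x' \<in> V" "y' \<in> V" "x = x'$1" "y = y'$1" by auto
    then show "x - y \<in> (\<lambda>x. x$1) ` V"
      using diff[of x' y'] by (intro image_eqI[of _ _ "x' - y'"]) auto
  qed
  then obtain a where a: "a \<in> V" "\<And>x. x \<in> V \<Longrightarrow> a$1 dvd x$1" by auto
  let ?W = "{x \<in> V. x$1 = 0}"
  have "\<exists>d\<in>(\<lambda>x. x$2) ` ?W. \<forall>x\<in>(\<lambda>x. x$2) ` ?W. d dvd x"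
  proof (rule int_set_diff_closed_principal)
    show "0 \<in> (\<lambda>x. x$2) ` ?W" using zero by force
    fix x y assume "x \<in> (\<lambda>x. x$2) ` ?W" "y \<in> (\<lambda>x. x$2) ` ?W"
    then obtain x' y' where "x' \<in> ?W" "y' \<in> ?W" "x = x'$2" "y = y'$2" by auto
    then show "x - y \<in> (\<lambda>x. x$2) ` ?W"
      using diff[of x' y'] by (intro image_eqI[of _ _ "x' - y'"]) auto
  qed
  then obtain b where b: "b \<in> V" "b$1 = 0" "\<And>x. x \<in> V \<Longrightarrow> x$1 = 0 \<Longrightarrow> b$2 dvd x$2" by auto
  have "\<exists>m n. x = m *s a + n *s b" if x: "x \<in> V" for x
  proof -
    obtain m where m: "x$1 = a$1 * m" using a(2)[OF x] by (elim dvdE)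
    have "x - m *s a \<in> V" using diff[OF x mult[OF a(1)]] .
    moreover have "(x - m *s a)$1 = 0" using m by simp
    ultimately have "b$2 dvd (x - m *s a)$2" by (rule b(3))
    then obtain n where "(x - m *s a)$2 = b$2 * n" by (elim dvdE)
    then have "x = m *s a + n *s b" using m b(2) by (simp add: vec_eq_iff forall_2 algebra_simps)
    then show ?thesis by blast
  qed
  then show ?thesis using a(1) b(1) by blast
qed

section \<open>Orbits of hyperbolic matrices\<close>

text \<open>The determinant of the matrix with columns \<open>v\<close> and \<open>w\<close>; it is
  nonzero iff they are linearly independent over the rationals.\<close>

definition wedge :: "int^2 \<Rightarrow> int^2 \<Rightarrow> int" where
  "wedge v w = v$1 * w$2 - v$2 * w$1"

text \<open>
  Completing the square, \<open>4 c (v \<and> h v) = (2 c x + (d - a) y)\<^sup>2 - (t\<^sup>2 - 4) y\<^sup>2\<close>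
  for \<open>h = (a, b; c, d)\<close> of trace \<open>t\<close> and \<open>v = (x, y)\<close>, and \<open>t\<^sup>2 - 4\<close> is not a square.
\<close>
lemma wedge_hyperbolic_nonzero:
  assumes det: "det h = 1" and hyp: "hyperbolic h" and v: "v \<noteq> 0"
  shows "wedge v (h *v v) \<noteq> 0"
proof
  assume 0: "wedge v (h *v v) = 0"
  define a b c d x y where "a = h$1$1" and "b = h$1$2" and "c = h$2$1" and "d = h$2$2"
    and "x = v$1" and "y = v$2"
  note defs = a_def b_def c_def d_def x_def y_def
  have ad: "a * d - b * c = 1" using det by (simp add: det_2 defs)
  have tr: "2 < \<bar>a + d\<bar>" using hyp by (simp add: hyperbolic_def trace_def sum_2 defs)
  have xy: "x \<noteq> 0 \<or> y \<noteq> 0" using v by (auto simp: vec_eq_iff forall_2 defs)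
  have q: "x * (c * x + d * y) - y * (a * x + b * y) = 0"
    using 0 by (simp add: wedge_def matrix_vector_mult_def sum_2 defs)
  have c: "c \<noteq> 0"
  proof
    assume "c = 0"
    then have "a * d = 1" using ad by simp
    then have "(a = 1 \<and> d = 1) \<or> (a = -1 \<and> d = -1)" by (simp add: zmult_eq_1_iff)
    then show False using tr by auto
  qed
  have sq: "(2 * c * x + (d - a) * y)\<^sup>2 = ((a + d)\<^sup>2 - 4) * y\<^sup>2"
  proof -
    have "(2 * c * x + (d - a) * y)\<^sup>2 - ((a + d)\<^sup>2 - 4) * y\<^sup>2
        = 4 * c * (x * (c * x + d * y) - y * (a * x + b * y)) + 4 * (1 - (a * d - b * c)) * y\<^sup>2"
      by (simp add: power2_eq_square algebra_simps)
    then show ?thesis using q ad by simp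
  qed
  have y: "y \<noteq> 0"
  proof
    assume "y = 0"
    then show False using q c xy by simp
  qed
  have "y\<^sup>2 dvd (2 * c * x + (d - a) * y)\<^sup>2" using sq by simp
  then have "y dvd 2 * c * x + (d - a) * y" by (simp add: pow_divides_pow_iff)
  then obtain s where "2 * c * x + (d - a) * y = y * s" by (elim dvdE)
  then have "s\<^sup>2 * y\<^sup>2 = ((a + d)\<^sup>2 - 4) * y\<^sup>2" using sq by (simp add: power_mult_distrib mult.commute)
  \<comment> \<open>Two squares would differ by 4. With t = a + d, the bound |s| \<le> |t| - 1 gives
    2 |t| \<le> 5, against |t| \<ge> 3.\<close>
  then have s: "\<bar>s\<bar>\<^sup>2 = \<bar>a + d\<bar>\<^sup>2 - 4" using y by simp
  then have "\<bar>s\<bar>\<^sup>2 < \<bar>a + d\<bar>\<^sup>2" by simp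
  then have "\<bar>s\<bar> \<le> \<bar>a + d\<bar> - 1" using power2_less_imp_less[of "\<bar>s\<bar>" "\<bar>a + d\<bar>"] by simp
  then have "\<bar>s\<bar>\<^sup>2 \<le> (\<bar>a + d\<bar> - 1)\<^sup>2" by (rule power_mono) simp
  then show False using s tr by (simp add: power2_eq_square algebra_simps)
qed

lemma matrix_vector_mult_scale:
  fixes A :: "'a::comm_semiring_1^'n^'m"
  shows "A *v (c *s x) = c *s (A *v x)"
  by (simp add: vec_eq_iff matrix_vector_mult_def sum_distrib_left mult.left_commute)

text \<open>Only the nonvanishing of \<open>s\<close> is wanted; the inequality is the invariant
  that carries it through the induction. The next coefficient is s t - s' with t the trace, and |s t
  - s'| \<ge> 3 |s| - |s'| > |s|.\<close>

lemma hyperbolic_orbit_recurrence: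
  assumes det: "det h = 1" and hyp: "hyperbolic h"
  shows "\<exists>s s'. \<bar>s'\<bar> < \<bar>s\<bar> \<and> (((*v) h) ^^ Suc k) v = s *s (h *v v) - s' *s v"
proof (induction k)
  case 0
  show ?case by (intro exI[of _ 1] exI[of _ 0]) (simp add: vec_eq_iff)
next
  case (Suc k)
  then obtain s s' where s: "\<bar>s'\<bar> < \<bar>s\<bar>" "(((*v) h) ^^ Suc k) v = s *s (h *v v) - s' *s v" by blast
  let ?t = "trace h"
  have tr: "3 \<le> \<bar>?t\<bar>" using hyp by (simp add: hyperbolic_def)
  \<comment> \<open>Cayley-Hamilton for determinant 1.\<close>
  have CH: "h *v (h *v v) = ?t *s (h *v v) - v"
  proof -
    have d: "h$1$1 * h$2$2 = 1 + h$1$2 * h$2$1" using det by (simp add: det_2)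
    have "(h *v (h *v v))$1 = (?t *s (h *v v) - v)$1 + (h$1$2 * h$2$1 - h$1$1 * h$2$2 + 1) * v$1"
      "(h *v (h *v v))$2 = (?t *s (h *v v) - v)$2 + (h$1$2 * h$2$1 - h$1$1 * h$2$2 + 1) * v$2"
      by (simp_all add: matrix_vector_mult_def trace_def sum_2 algebra_simps)
    then show ?thesis using d by (simp add: vec_eq_iff forall_2)
  qed
  have "(((*v) h) ^^ Suc (Suc k)) v = s *s (h *v (h *v v)) - s' *s (h *v v)"
    using s(2) by (simp only: funpow.simps(2) o_def matrix_vector_mult_diff_distrib matrix_vector_mult_scale)
  also have "\<dots> = (s * ?t - s') *s (h *v v) - s *s v"
    unfolding CH by (simp add: vec_eq_iff algebra_simps)
  finally have eq: "(((*v) h) ^^ Suc (Suc k)) v = (s * ?t - s') *s (h *v v) - s *s v" .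
  have "\<bar>s\<bar> * 3 \<le> \<bar>s * ?t\<bar>" unfolding abs_mult by (rule mult_left_mono) (use tr in auto)
  then have "\<bar>s\<bar> < \<bar>s * ?t - s'\<bar>" using s(1) by linarith
  with eq show ?case by blast
qed

text \<open>Starting from w = h^i v, the recurrence writes h^j v as s h w - s' w. As the form is
  alternating, the second term drops out, and the case of consecutive orbit points remains.\<close>

lemma wedge_hyperbolic_orbit_nonzero:
  assumes det: "det h = 1" and hyp: "hyperbolic h" and v: "v \<noteq> 0" and "i < j"
  shows "wedge ((((*v) h) ^^ i) v) ((((*v) h) ^^ j) v) \<noteq> 0"
proof -
  have nz: "(((*v) h) ^^ n) v \<noteq> 0" for n
  proof (induction n)
    case (Suc n)
    have "wedge ((((*v) h) ^^ n) v) (h *v (((*v) h) ^^ n) v) \<noteq> 0"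
      by (rule wedge_hyperbolic_nonzero[OF det hyp Suc])
    then show ?case by (auto simp: wedge_def)
  qed (use v in simp)
  obtain k where j: "j = Suc k + i" using \<open>i < j\<close> less_imp_Suc_add by (metis add.commute add_Suc_right)
  let ?w = "(((*v) h) ^^ i) v"
  obtain s s' where s: "\<bar>s'\<bar> < \<bar>s\<bar>" "(((*v) h) ^^ Suc k) ?w = s *s (h *v ?w) - s' *s ?w"
    using hyperbolic_orbit_recurrence[OF det hyp] by blast
  have "(((*v) h) ^^ j) v = s *s (h *v ?w) - s' *s ?w" unfolding j funpow_add using s(2) by simp
  then have "wedge ?w ((((*v) h) ^^ j) v) = wedge ?w (s *s (h *v ?w) - s' *s ?w)" by simp
  also have "\<dots> = s * wedge ?w (h *v ?w)" by (simp add: wedge_def algebra_simps)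
  finally have "wedge ?w ((((*v) h) ^^ j) v) = s * wedge ?w (h *v ?w)" .
  then show ?thesis using s(1) wedge_hyperbolic_nonzero[OF det hyp nz] by auto
qed


section \<open>Subgroups of \<open>\<Lambda> \<ltimes> \<int>\<^sup>2\<close>\<close>

lemma semidirect_Z2_simps:
  "(A, v) \<in> carrier (semidirect_Z2 \<Lambda>) \<longleftrightarrow> A \<in> \<Lambda>"
  "(A, v) \<otimes>\<^bsub>semidirect_Z2 \<Lambda>\<^esub> (B, w) = (A ** B, v + A *v w)"
  "\<one>\<^bsub>semidirect_Z2 \<Lambda>\<^esub> = (mat 1, 0)"
  by (simp_all add: semidirect_Z2_def)

context
  fixes \<Lambda> :: "(int^2^2) set"
  assumes \<Lambda>: "subgroup \<Lambda> SL2Z"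
begin

interpretation G: group "semidirect_Z2 \<Lambda>" by (rule group_semidirect_Z2[OF \<Lambda>])

lemma SL2Z_subgroup_one: "mat 1 \<in> \<Lambda>"
  using subgroup.one_closed[OF \<Lambda>] by (simp add: SL2Z_def)

lemma SL2Z_subgroup_mult: "A \<in> \<Lambda> \<Longrightarrow> B \<in> \<Lambda> \<Longrightarrow> A ** B \<in> \<Lambda>"
  using subgroup.m_closed[OF \<Lambda>] by (simp add: SL2Z_def)

lemma SL2Z_subgroup_det: "A \<in> \<Lambda> \<Longrightarrow> det A = 1"
  using subgroup.subset[OF \<Lambda>] by (auto simp: SL2Z_def)

lemma SL2Z_subgroup_inverse:
  assumes "A \<in> \<Lambda>"
  obtains B where "B \<in> \<Lambda>" "A ** B = mat 1" "B ** A = mat 1"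
proof -
  interpret S: group SL2Z by (rule group_SL2Z)
  have "A \<in> carrier SL2Z" using assms subgroup.subset[OF \<Lambda>] by blast
  then have "A ** inv\<^bsub>SL2Z\<^esub> A = mat 1" "inv\<^bsub>SL2Z\<^esub> A ** A = mat 1"
    using S.r_inv[of A] S.l_inv[of A] by (simp_all add: SL2Z_def)
  then show thesis using that subgroup.m_inv_closed[OF \<Lambda> assms] by blast
qed

lemma semidirect_Z2_inv:
  assumes "A \<in> \<Lambda>" "B \<in> \<Lambda>" "B ** A = mat 1"
  shows "inv\<^bsub>semidirect_Z2 \<Lambda>\<^esub> (A, v) = (B, - (B *v v))"
  by (rule G.inv_equality) (simp_all add: semidirect_Z2_simps assms)

lemma semidirect_Z2_inv_translation:
  "inv\<^bsub>semidirect_Z2 \<Lambda>\<^esub> (mat 1, v) = (mat 1, - v)"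
  using semidirect_Z2_inv[of "mat 1" "mat 1" v] SL2Z_subgroup_one by simp

lemma translation_multiple_closed:
  assumes H: "subgroup H (semidirect_Z2 \<Lambda>)" and x: "(mat 1, x) \<in> H"
  shows "(mat 1, k *s x) \<in> H"
proof (induction k rule: int_induct[where k = 0])
  case base
  show ?case using subgroup.one_closed[OF H] by (simp add: semidirect_Z2_simps)
next
  case (step1 i)
  then show ?case
    using subgroup.m_closed[OF H step1(2) x] by (simp add: semidirect_Z2_simps vector_sadd_rdistrib)
next
  case (step2 i)
  have "(i - 1) *s x = i *s x + - x" by (simp add: vec_eq_iff algebra_simps)
  then show ?case
    using subgroup.m_closed[OF H step2(2) subgroup.m_inv_closed[OF H x]]
    by (simp add: semidirect_Z2_simps semidirect_Z2_inv_translation)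
qed

lemma translation_add_closed:
  assumes H: "subgroup H (semidirect_Z2 \<Lambda>)" and "(mat 1, x) \<in> H" "(mat 1, y) \<in> H"
  shows "(mat 1, x + y) \<in> H"
  using subgroup.m_closed[OF assms] by (simp add: semidirect_Z2_simps)

lemma translation_diff_closed:
  assumes H: "subgroup H (semidirect_Z2 \<Lambda>)" and "(mat 1, x) \<in> H" "(mat 1, y) \<in> H"
  shows "(mat 1, x - y) \<in> H"
  using subgroup.m_closed[OF H assms(2) subgroup.m_inv_closed[OF H assms(3)]]
  by (simp add: semidirect_Z2_simps semidirect_Z2_inv_translation)

section \<open>Bounds for the index of the translation part\<close>

text \<open>As \<open>H\<close> contains d Z^2, reducing both coordinates modulo |d| leaves at most
  d^2 cosets.\<close>

lemma translation_index_le: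
  assumes H: "subgroup H (semidirect_Z2 \<Lambda>)" and d: "d \<noteq> 0"
    and mem: "\<And>x. (mat 1, d *s x) \<in> H"
  shows "subgroup_index ((semidirect_Z2 \<Lambda>)\<lparr>carrier := translation_subgroup\<rparr>)
           (H \<inter> translation_subgroup) \<le> nat \<bar>d\<bar> * nat \<bar>d\<bar>"
proof -
  let ?T = "translation_subgroup" and ?D = "{0..<\<bar>d\<bar>}"
  have HT: "subgroup (H \<inter> ?T) (semidirect_Z2 \<Lambda>)"
    by (rule G.subgroups_Inter_pair[OF H subgroup_translation_subgroup[OF \<Lambda>]])
  let ?f = "\<lambda>(a, b). (mat 1, vector [a, b]) <#\<^bsub>semidirect_Z2 \<Lambda>\<^esub> (H \<inter> ?T)"
  have "lcosets\<^bsub>(semidirect_Z2 \<Lambda>)\<lparr>carrier := ?T\<rparr>\<^esub> (H \<inter> ?T) \<subseteq> ?f ` (?D \<times> ?D)"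
  proof
    fix C assume "C \<in> lcosets\<^bsub>(semidirect_Z2 \<Lambda>)\<lparr>carrier := ?T\<rparr>\<^esub> (H \<inter> ?T)"
    then obtain x where C: "C = (mat 1, x) <#\<^bsub>semidirect_Z2 \<Lambda>\<^esub> (H \<inter> ?T)"
      by (auto simp: LCOSETS_def translation_subgroup_def)
    define y where "y = (\<chi> i. x$i div \<bar>d\<bar>)"
    define r :: "int^2" where "r = vector [x$1 mod \<bar>d\<bar>, x$2 mod \<bar>d\<bar>]"
    have "x - r = \<bar>d\<bar> *s y"
      by (simp add: vec_eq_iff forall_2 r_def y_def minus_mod_eq_mult_div)
    \<comment> \<open>The sign of \<open>d\<close> is absorbed into the vector, because
      \<open>mem\<close> speaks of multiples of \<open>d\<close> and the reduction is modulo its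
      absolute value.\<close>
    also have "\<dots> = d *s (sgn d *s y)" by (simp add: vector_smult_assoc abs_sgn)
    finally have "(mat 1, x - r) \<in> H \<inter> ?T"
      using mem[of "sgn d *s y"] by (simp add: translation_subgroup_def)
    then have "(mat 1, r) <#\<^bsub>semidirect_Z2 \<Lambda>\<^esub> (H \<inter> ?T) = C"
      unfolding C using SL2Z_subgroup_one
      by (subst G.l_coset_eq_iff[OF HT]) (simp_all add: semidirect_Z2_simps semidirect_Z2_inv_translation)
    then show "C \<in> ?f ` (?D \<times> ?D)"
      using d by (intro image_eqI[of _ _ "(x$1 mod \<bar>d\<bar>, x$2 mod \<bar>d\<bar>)"]) (auto simp: r_def)
  qed
  then have "card (lcosets\<^bsub>(semidirect_Z2 \<Lambda>)\<lparr>carrier := ?T\<rparr>\<^esub> (H \<inter> ?T)) \<le> card (?D \<times> ?D)"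
    by (rule surj_card_le[rotated]) simp
  then show ?thesis by (simp add: subgroup_index_def card_cartesian_product)
qed

text \<open>If C = (B, z) H is fixed by the translation by u, conjugating by (B, z) shows that
  \<open>H\<close> contains the translation by the preimage of u under B. Applied to
  \<open>v\<close> and \<open>w\<close>, this yields a sublattice containing d Z^2 for d =
  \<open>wedge v w\<close>.\<close>

lemma common_fixed_translations_index_le:
  assumes H: "subgroup H (semidirect_Z2 \<Lambda>)"
    and C: "C \<in> lcosets\<^bsub>semidirect_Z2 \<Lambda>\<^esub> H"
    and v: "(mat 1, v) <#\<^bsub>semidirect_Z2 \<Lambda>\<^esub> C = C"
    and w: "(mat 1, w) <#\<^bsub>semidirect_Z2 \<Lambda>\<^esub> C = C"
    and vw: "wedge v w \<noteq> 0"
  shows "subgroup_index ((semidirect_Z2 \<Lambda>)\<lparr>carrier := translation_subgroup\<rparr>)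
           (H \<inter> translation_subgroup) \<le> nat \<bar>wedge v w\<bar> * nat \<bar>wedge v w\<bar>"
proof (rule translation_index_le[OF H vw])
  fix x :: "int^2"
  obtain B z where B: "B \<in> \<Lambda>" and CB: "C = (B, z) <#\<^bsub>semidirect_Z2 \<Lambda>\<^esub> H"
    using C by (auto simp: LCOSETS_def semidirect_Z2_def)
  obtain B' where B': "B' \<in> \<Lambda>" "B ** B' = mat 1" "B' ** B = mat 1" by (rule SL2Z_subgroup_inverse[OF B])
  have mem: "(mat 1, B' *v u) \<in> H" if u: "(mat 1, u) <#\<^bsub>semidirect_Z2 \<Lambda>\<^esub> C = C" for u
  proof -
    have "(B, z) <#\<^bsub>semidirect_Z2 \<Lambda>\<^esub> H = (B, u + z) <#\<^bsub>semidirect_Z2 \<Lambda>\<^esub> H"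
      using u B SL2Z_subgroup_one G.lcos_m_assoc[OF subgroup.subset[OF H], of "(mat 1, u)" "(B, z)"]
      unfolding CB by (simp add: semidirect_Z2_simps)
    then have "inv\<^bsub>semidirect_Z2 \<Lambda>\<^esub> (B, z) \<otimes>\<^bsub>semidirect_Z2 \<Lambda>\<^esub> (B, u + z) \<in> H"
      using G.l_coset_eq_iff[OF H, of "(B, z)" "(B, u + z)"] B by (simp add: semidirect_Z2_simps)
    then show ?thesis
      by (simp add: semidirect_Z2_inv[OF B B'(1,3)] semidirect_Z2_simps B'(3) matrix_vector_right_distrib)
  qed
  define y where "y = B *v x"
  have x: "x = B' *v y" by (simp add: y_def matrix_vector_mul_assoc B'(3))
  \<comment> \<open>Cramer's rule, cleared of the denominator \<open>wedge v w\<close>.\<close>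
  have "wedge v w *s y = wedge y w *s v + wedge v y *s w"
    by (simp add: wedge_def vec_eq_iff forall_2 algebra_simps)
  then have "wedge v w *s x = wedge y w *s (B' *v v) + wedge v y *s (B' *v w)"
    unfolding x by (simp only: matrix_vector_right_distrib matrix_vector_mult_scale[symmetric])
  then show "(mat 1, wedge v w *s x) \<in> H"
    using translation_add_closed[OF H translation_multiple_closed[OF H mem[OF v]]
        translation_multiple_closed[OF H mem[OF w]]] by simp
qed

private lemmas simps = semidirect_Z2_simps semidirect_Z2_inv_translation SL2Z_subgroup_one

section \<open>Fixed-point densities\<close>

lemma translation_fixed_density_tendsto_0:
  fixes N :: "nat \<Rightarrow> ((int^2^2) \<times> (int^2)) set"
  assumes hyp: "\<exists>A\<in>\<Lambda>. hyperbolic A"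
    and N: "\<And>n. subgroup (N n) (semidirect_Z2 \<Lambda>)"
    and fin: "\<And>n. finite (lcosets\<^bsub>semidirect_Z2 \<Lambda>\<^esub> (N n))"
    and lim: "filterlim (\<lambda>n. subgroup_index ((semidirect_Z2 \<Lambda>)\<lparr>carrier := translation_subgroup\<rparr>)
                          (N n \<inter> translation_subgroup)) at_top sequentially"
    and v: "v \<noteq> 0"
  shows "(\<lambda>n. real (card {C \<in> lcosets\<^bsub>semidirect_Z2 \<Lambda>\<^esub> (N n). (mat 1, v) <#\<^bsub>semidirect_Z2 \<Lambda>\<^esub> C = C})
            / real (card (lcosets\<^bsub>semidirect_Z2 \<Lambda>\<^esub> (N n)))) \<longlonglongrightarrow> 0"
proof -
  obtain h where h: "h \<in> \<Lambda>" "hyperbolic h" using hyp by blast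
  have det: "det h = 1" by (rule SL2Z_subgroup_det[OF h(1)])
  let ?y = "\<lambda>i. (((*v) h) ^^ i) v"
  \<comment> \<open>The witness is h^i; only its membership in \<Lambda> and its value at
    \<open>v\<close> matter for the conjugation.\<close>
  have "\<exists>B\<in>\<Lambda>. B *v v = ?y i" for i
  proof (induction i)
    case 0
    then show ?case using SL2Z_subgroup_one by (intro bexI[of _ "mat 1"]) auto
  next
    case (Suc i)
    then obtain B where "B \<in> \<Lambda>" "B *v v = ?y i" by blast
    then show ?case using SL2Z_subgroup_mult[OF h(1)]
      by (intro bexI[of _ "h ** B"]) (auto simp: matrix_vector_mul_assoc[symmetric])
  qed
  then obtain H where H: "\<And>i. H i \<in> \<Lambda>" "\<And>i. H i *v v = ?y i" by metis
  have conj: "(H i, 0) \<otimes>\<^bsub>semidirect_Z2 \<Lambda>\<^esub> (mat 1, v) \<otimes>\<^bsub>semidirect_Z2 \<Lambda>\<^esub> inv\<^bsub>semidirect_Z2 \<Lambda>\<^esub> (H i, 0)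
      = (mat 1, ?y i)" for i
  proof -
    obtain B where B: "B \<in> \<Lambda>" "H i ** B = mat 1" "B ** H i = mat 1"
      by (rule SL2Z_subgroup_inverse[OF H(1)])
    show ?thesis by (simp add: simps semidirect_Z2_inv[OF H(1) B(1,3)] B(2) H(2))
  qed
  show ?thesis
  proof (rule G.lcosets_fixed_density_tendsto_0[OF N fin, where g = "\<lambda>i. (H i, 0)"], goal_cases)
    case (3 i j)
    let ?d = "wedge (?y i) (?y j)"
    have d: "?d \<noteq> 0" by (rule wedge_hyperbolic_orbit_nonzero[OF det h(2) v 3])
    \<comment> \<open>One more than the bound that any common fixed coset would impose on the index.
      From then on no coset is fixed by both conjugates, so the density is eventually equal to
      0.\<close>
    have "\<forall>\<^sub>F n in sequentially.
        Suc (nat \<bar>?d\<bar> * nat \<bar>?d\<bar>) \<le> subgroup_index ((semidirect_Z2 \<Lambda>)\<lparr>carrier := translation_subgroup\<rparr>)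
                          (N n \<inter> translation_subgroup)"
      using lim unfolding filterlim_at_top by blast
    then have "\<forall>\<^sub>F n in sequentially.
        {C \<in> lcosets\<^bsub>semidirect_Z2 \<Lambda>\<^esub> (N n). (mat 1, ?y i) <#\<^bsub>semidirect_Z2 \<Lambda>\<^esub> C = C
            \<and> (mat 1, ?y j) <#\<^bsub>semidirect_Z2 \<Lambda>\<^esub> C = C} = {}"
    proof eventually_elim
      case (elim n)
      show ?case
        using common_fixed_translations_index_le[OF N _ _ _ d] elim not_less_eq_eq by blast
    qed
    then have "\<forall>\<^sub>F n in sequentially.
        real (card {C \<in> lcosets\<^bsub>semidirect_Z2 \<Lambda>\<^esub> (N n). (mat 1, ?y i) <#\<^bsub>semidirect_Z2 \<Lambda>\<^esub> C = C
            \<and> (mat 1, ?y j) <#\<^bsub>semidirect_Z2 \<Lambda>\<^esub> C = C}) / real (card (lcosets\<^bsub>semidirect_Z2 \<Lambda>\<^esub> (N n))) = 0"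
      by eventually_elim (simp only: card.empty of_nat_0 div_0)
    then show ?case unfolding conj by (rule tendsto_eventually)
  qed (simp_all add: simps H)
qed

lemma fixed_density_tendsto_0:
  fixes N :: "nat \<Rightarrow> ((int^2^2) \<times> (int^2)) set"
  assumes hyp: "\<exists>A\<in>\<Lambda>. hyperbolic A"
    and N: "\<And>n. subgroup (N n) (semidirect_Z2 \<Lambda>)"
    and fin: "\<And>n. finite (lcosets\<^bsub>semidirect_Z2 \<Lambda>\<^esub> (N n))"
    and lim: "filterlim (\<lambda>n. subgroup_index ((semidirect_Z2 \<Lambda>)\<lparr>carrier := translation_subgroup\<rparr>)
                          (N n \<inter> translation_subgroup)) at_top sequentially"
    and g: "g \<in> carrier (semidirect_Z2 \<Lambda>)" "g \<noteq> \<one>\<^bsub>semidirect_Z2 \<Lambda>\<^esub>"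
  shows "(\<lambda>n. real (card {C \<in> lcosets\<^bsub>semidirect_Z2 \<Lambda>\<^esub> (N n). g <#\<^bsub>semidirect_Z2 \<Lambda>\<^esub> C = C})
            / real (card (lcosets\<^bsub>semidirect_Z2 \<Lambda>\<^esub> (N n)))) \<longlonglongrightarrow> 0"
proof -
  obtain A v where Av: "g = (A, v)" and A: "A \<in> \<Lambda>" using g by (cases g) (auto simp: simps)
  note transl = translation_fixed_density_tendsto_0[OF hyp N fin lim]
  show ?thesis
  proof (cases "A = mat 1")
    case True
    then have "v \<noteq> 0" using g Av by (auto simp: simps)
    then show ?thesis using transl Av True by simp
  next
    case False
    then obtain u where u: "A *v u \<noteq> u" using matrix_eq[of A "mat 1"] by auto
    define w where "w = A *v u - u"
    have w: "w \<noteq> 0" using u by (simp add: w_def)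
    let ?g = "\<lambda>i. (mat 1, int i *s u) :: (int^2^2) \<times> (int^2)"
    have conj: "?g i \<otimes>\<^bsub>semidirect_Z2 \<Lambda>\<^esub> (A, v) \<otimes>\<^bsub>semidirect_Z2 \<Lambda>\<^esub> inv\<^bsub>semidirect_Z2 \<Lambda>\<^esub> (?g i)
      = (A, v - int i *s w)" for i
    proof -
      have "A *v (- (int i *s u)) = - (int i *s (A *v u))"
        using matrix_vector_mult_diff_distrib[of A 0 "int i *s u"] by (simp add: matrix_vector_mult_scale)
      then show ?thesis by (simp add: simps w_def vec_eq_iff algebra_simps)
    qed
    show ?thesis unfolding Av
    proof (rule G.lcosets_fixed_density_tendsto_0[OF N fin, where g = ?g], goal_cases)
      case (3 i j)
      let ?z = "int (j - i) *s w"
      have z: "?z \<noteq> 0" using w 3 by (auto simp: vec_eq_iff)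
      \<comment> \<open>Both conjugates have linear part \<open>A\<close>, and left multiplication
        by the translation by \<open>?z\<close> turns the second into the first. That translation
        therefore fixes every common fixed coset.\<close>
      have sub: "{C \<in> lcosets\<^bsub>semidirect_Z2 \<Lambda>\<^esub> (N n). (A, v - int i *s w) <#\<^bsub>semidirect_Z2 \<Lambda>\<^esub> C = C
            \<and> (A, v - int j *s w) <#\<^bsub>semidirect_Z2 \<Lambda>\<^esub> C = C}
          \<subseteq> {C \<in> lcosets\<^bsub>semidirect_Z2 \<Lambda>\<^esub> (N n). (mat 1, ?z) <#\<^bsub>semidirect_Z2 \<Lambda>\<^esub> C = C}" for n
      proof clarify
        fix C
        assume C: "C \<in> lcosets\<^bsub>semidirect_Z2 \<Lambda>\<^esub> (N n)"
          and i: "(A, v - int i *s w) <#\<^bsub>semidirect_Z2 \<Lambda>\<^esub> C = C"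
          and j: "(A, v - int j *s w) <#\<^bsub>semidirect_Z2 \<Lambda>\<^esub> C = C"
        have CG: "C \<subseteq> carrier (semidirect_Z2 \<Lambda>)"
          using subgroup.lcosets_carrier[OF N G.is_group C] .
        have "(mat 1, ?z) <#\<^bsub>semidirect_Z2 \<Lambda>\<^esub> C
            = (mat 1, ?z) <#\<^bsub>semidirect_Z2 \<Lambda>\<^esub> ((A, v - int j *s w) <#\<^bsub>semidirect_Z2 \<Lambda>\<^esub> C)"
          using j by simp
        also have "\<dots> = ((mat 1, ?z) \<otimes>\<^bsub>semidirect_Z2 \<Lambda>\<^esub> (A, v - int j *s w)) <#\<^bsub>semidirect_Z2 \<Lambda>\<^esub> C"
          using G.lcos_m_assoc[OF CG] A by (simp add: simps)
        also have "(mat 1, ?z) \<otimes>\<^bsub>semidirect_Z2 \<Lambda>\<^esub> (A, v - int j *s w) = (A, v - int i *s w)"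
          using 3 by (simp add: simps vec_eq_iff algebra_simps of_nat_diff)
        finally show "(mat 1, ?z) <#\<^bsub>semidirect_Z2 \<Lambda>\<^esub> C = C" using i by simp
      qed
      show ?case unfolding conj
      proof (rule tendsto_sandwich[OF _ _ tendsto_const transl[OF z]])
        show "\<forall>\<^sub>F n in sequentially.
            real (card {C \<in> lcosets\<^bsub>semidirect_Z2 \<Lambda>\<^esub> (N n). (A, v - int i *s w) <#\<^bsub>semidirect_Z2 \<Lambda>\<^esub> C = C
              \<and> (A, v - int j *s w) <#\<^bsub>semidirect_Z2 \<Lambda>\<^esub> C = C}) / real (card (lcosets\<^bsub>semidirect_Z2 \<Lambda>\<^esub> (N n)))
            \<le> real (card {C \<in> lcosets\<^bsub>semidirect_Z2 \<Lambda>\<^esub> (N n). (mat 1, ?z) <#\<^bsub>semidirect_Z2 \<Lambda>\<^esub> C = C})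
              / real (card (lcosets\<^bsub>semidirect_Z2 \<Lambda>\<^esub> (N n)))"
          using fin by (intro always_eventually allI divide_right_mono of_nat_mono card_mono[OF _ sub]) auto
      qed simp
    qed (simp_all add: simps A)
  qed
qed

section \<open>Rank of finite-index subgroups\<close>

text \<open>The translation part is a subgroup of Z^2. Generation is taken in the whole group, so
  that these generators can later be joined with others from \<open>H\<close>.\<close>

lemma translation_part_two_generators:
  assumes H: "subgroup H (semidirect_Z2 \<Lambda>)"
  shows "\<exists>S\<subseteq>H. finite S \<and> card S \<le> 2 \<and> H \<inter> translation_subgroup \<subseteq> generate (semidirect_Z2 \<Lambda>) S"
proof -
  define V where "V = {x. (mat 1, x) \<in> H}"
  have "0 \<in> V" using subgroup.one_closed[OF H] by (simp add: V_def simps)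
  then have "\<exists>a\<in>V. \<exists>b\<in>V. \<forall>x\<in>V. \<exists>m n. x = m *s a + n *s b"
    by (rule int2_set_diff_closed_two_generators)
      (auto simp: V_def intro: translation_diff_closed[OF H] translation_multiple_closed[OF H])
  then obtain a b where ab: "a \<in> V" "b \<in> V" "\<And>x. x \<in> V \<Longrightarrow> \<exists>m n. x = m *s a + n *s b" by blast
  let ?S = "{(mat 1, a), (mat 1, b)}"
  have SH: "?S \<subseteq> H" using ab by (simp add: V_def)
  have gen: "subgroup (generate (semidirect_Z2 \<Lambda>) ?S) (semidirect_Z2 \<Lambda>)"
    using SH subgroup.subset[OF H] by (intro G.generate_is_subgroup) blast
  have "H \<inter> translation_subgroup \<subseteq> generate (semidirect_Z2 \<Lambda>) ?S"
  proof
    fix p assume "p \<in> H \<inter> translation_subgroup"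
    then obtain x where x: "p = (mat 1, x)" "x \<in> V" by (auto simp: translation_subgroup_def V_def)
    then obtain m n where mn: "x = m *s a + n *s b" using ab(3) by blast
    have "(mat 1, a) \<in> generate (semidirect_Z2 \<Lambda>) ?S" "(mat 1, b) \<in> generate (semidirect_Z2 \<Lambda>) ?S"
      by (auto intro: generate.incl)
    then show "p \<in> generate (semidirect_Z2 \<Lambda>) ?S"
      unfolding x(1) mn by (intro translation_add_closed[OF gen] translation_multiple_closed[OF gen])
  qed
  then show ?thesis using SH by (intro exI[of _ ?S]) (auto simp: card_insert_if)
qed

text \<open>This set is the product of \<open>H\<close> with the translations, encoded as the
  preimage of the projection of \<open>H\<close> to \<Lambda>. In this form, closure reduces to a
  statement about linear parts.\<close>

lemma subgroup_fst_preimage: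
  assumes H: "subgroup H (semidirect_Z2 \<Lambda>)"
  shows "subgroup {p \<in> carrier (semidirect_Z2 \<Lambda>). fst p \<in> fst ` H} (semidirect_Z2 \<Lambda>)" (is "subgroup ?K _")
proof (rule G.subgroupI)
  have "\<one>\<^bsub>semidirect_Z2 \<Lambda>\<^esub> \<in> ?K" using subgroup.one_closed[OF H] G.one_closed by blast
  then show "?K \<noteq> {}" by blast
  fix p assume p: "p \<in> ?K"
  then obtain A v w where Av: "p = (A, v)" "(A, w) \<in> H" "A \<in> \<Lambda>" by (cases p) (force simp: simps)
  obtain B where B: "B \<in> \<Lambda>" "B ** A = mat 1" by (rule SL2Z_subgroup_inverse[OF Av(3)])
  have "inv\<^bsub>semidirect_Z2 \<Lambda>\<^esub> (A, w) \<in> H" by (rule subgroup.m_inv_closed[OF H Av(2)])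
  then show "inv\<^bsub>semidirect_Z2 \<Lambda>\<^esub> p \<in> ?K"
    unfolding Av(1) semidirect_Z2_inv[OF Av(3) B] using B(1) by (force simp: simps)
next
  fix p q assume p: "p \<in> ?K" and q: "q \<in> ?K"
  obtain A v w where A: "p = (A, v)" "(A, w) \<in> H" using p by (cases p) force
  obtain B x y where B: "q = (B, x)" "(B, y) \<in> H" using q by (cases q) force
  have "(A, w) \<otimes>\<^bsub>semidirect_Z2 \<Lambda>\<^esub> (B, y) \<in> H" by (rule subgroup.m_closed[OF H A(2) B(2)])
  then have "A ** B \<in> fst ` H" by (force simp: simps)
  moreover have "p \<otimes>\<^bsub>semidirect_Z2 \<Lambda>\<^esub> q \<in> carrier (semidirect_Z2 \<Lambda>)" using p q by simp
  ultimately show "p \<otimes>\<^bsub>semidirect_Z2 \<Lambda>\<^esub> q \<in> ?K" by (simp add: simps A(1) B(1))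
qed auto

text \<open>
  Schreier's bound is applied to \<open>H \<int>\<^sup>2\<close>; lifting its generators to \<open>H\<close> leaves only the
  translations of \<open>H\<close> to be generated.
\<close>
lemma group_rank_subgroup_le:
  assumes H: "subgroup H (semidirect_Z2 \<Lambda>)"
    and fin: "finite (lcosets\<^bsub>semidirect_Z2 \<Lambda>\<^esub> H)"
    and S: "finite S" "S \<subseteq> carrier (semidirect_Z2 \<Lambda>)"
      "generate (semidirect_Z2 \<Lambda>) S = carrier (semidirect_Z2 \<Lambda>)"
  shows "\<exists>k\<ge>1. group_rank ((semidirect_Z2 \<Lambda>)\<lparr>carrier := H\<rparr>) \<le> enat (k * card S + 2)
    \<and> k * subgroup_index ((semidirect_Z2 \<Lambda>)\<lparr>carrier := translation_subgroup\<rparr>) (H \<inter> translation_subgroup)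
        \<le> subgroup_index (semidirect_Z2 \<Lambda>) H"
proof -
  let ?K = "{p \<in> carrier (semidirect_Z2 \<Lambda>). fst p \<in> fst ` H}"
  have K: "subgroup ?K (semidirect_Z2 \<Lambda>)" by (rule subgroup_fst_preimage[OF H])
  have HK: "H \<subseteq> ?K" using subgroup.subset[OF H] by auto
  have TK: "translation_subgroup \<subseteq> ?K"
    using subgroup.one_closed[OF H] by (force simp: translation_subgroup_def simps)
  have finK: "finite (lcosets\<^bsub>semidirect_Z2 \<Lambda>\<^esub> ?K)" by (rule G.lcosets_subset_finite[OF H K HK fin])
  define k where "k = card (lcosets\<^bsub>semidirect_Z2 \<Lambda>\<^esub> ?K)"
  have "lcosets\<^bsub>semidirect_Z2 \<Lambda>\<^esub> ?K \<noteq> {}" using G.l_coset_in_lcosets[OF G.one_closed] by blast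
  then have k: "k \<ge> 1" using finK by (simp add: k_def Suc_le_eq card_gt_0_iff)
  obtain T where T: "T \<subseteq> ?K" "finite T" "card T \<le> k * card S" "generate (semidirect_Z2 \<Lambda>) T = ?K"
    using G.Schreier_generators[OF K finK S] unfolding k_def by blast
  have "\<exists>q\<in>H. fst q = fst p" if "p \<in> T" for p
  proof -
    have "fst p \<in> fst ` H" using that T(1) by blast
    then show ?thesis by (metis imageE)
  qed
  then obtain l where l: "\<And>p. p \<in> T \<Longrightarrow> l p \<in> H" "\<And>p. p \<in> T \<Longrightarrow> fst (l p) = fst p" by metis
  obtain V where V: "V \<subseteq> H" "finite V" "card V \<le> 2"
      "H \<inter> translation_subgroup \<subseteq> generate (semidirect_Z2 \<Lambda>) V"
    using translation_part_two_generators[OF H] by blast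
  let ?R = "l ` T \<union> V"
  have RH: "?R \<subseteq> H" using l(1) V(1) by blast
  interpret R: subgroup "generate (semidirect_Z2 \<Lambda>) ?R" "semidirect_Z2 \<Lambda>"
    using RH subgroup.subset[OF H] by (intro G.generate_is_subgroup) blast
  have RH': "generate (semidirect_Z2 \<Lambda>) ?R \<subseteq> H" by (rule G.generate_subgroup_incl[OF RH H])
  have fst_mult: "fst (p \<otimes>\<^bsub>semidirect_Z2 \<Lambda>\<^esub> q) = fst p ** fst q" for p q
    by (cases p, cases q) (simp add: simps)
  have fst_inv: "fst (inv\<^bsub>semidirect_Z2 \<Lambda>\<^esub> p) = fst (inv\<^bsub>semidirect_Z2 \<Lambda>\<^esub> q)"
    if pq: "p \<in> carrier (semidirect_Z2 \<Lambda>)" "fst p = fst q" for p q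
  proof -
    obtain A v w where Av: "p = (A, v)" "q = (A, w)" "A \<in> \<Lambda>"
      using pq by (cases p, cases q) (auto simp: simps)
    obtain B where B: "B \<in> \<Lambda>" "B ** A = mat 1" by (rule SL2Z_subgroup_inverse[OF Av(3)])
    show ?thesis by (simp add: Av(1,2) semidirect_Z2_inv[OF Av(3) B])
  qed
  \<comment> \<open>A word in \<open>T\<close> is read in the lifts \<open>l p\<close> instead.
    Taking linear parts is a homomorphism, so the linear part stays the same.\<close>
  have lift: "\<exists>q\<in>generate (semidirect_Z2 \<Lambda>) ?R. fst q = fst p"
    if "p \<in> generate (semidirect_Z2 \<Lambda>) T" for p
    using that
  proof (induction p rule: generate.induct)
    case one
    then show ?case using R.one_closed by blast
  next
    case (incl p)
    then show ?case using l(2) by (intro bexI[of _ "l p"] generate.incl) auto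
  next
    case (inv p)
    then have "p \<in> carrier (semidirect_Z2 \<Lambda>)" using T(1) by blast
    then show ?case using fst_inv[of p "l p"] l(2)[OF inv] inv
      by (intro bexI[of _ "inv\<^bsub>semidirect_Z2 \<Lambda>\<^esub> (l p)"] generate.inv) auto
  next
    case (eng p q)
    then show ?case using R.m_closed fst_mult by metis
  qed
  have "H \<subseteq> generate (semidirect_Z2 \<Lambda>) ?R"
  proof
    fix p assume p: "p \<in> H"
    then obtain q where q: "q \<in> generate (semidirect_Z2 \<Lambda>) ?R" "fst q = fst p"
      using lift T(4) HK by blast
    have pq: "p \<in> carrier (semidirect_Z2 \<Lambda>)" "q \<in> carrier (semidirect_Z2 \<Lambda>)"
      using p q(1) HK by auto
    \<comment> \<open>Since \<open>p\<close> and \<open>q\<close> have the same linear part and both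
      lie in \<open>H\<close>, this is a translation in \<open>H\<close>, hence generated by
      \<open>V\<close>.\<close>
    let ?t = "inv\<^bsub>semidirect_Z2 \<Lambda>\<^esub> q \<otimes>\<^bsub>semidirect_Z2 \<Lambda>\<^esub> p"
    have "fst ?t = fst (inv\<^bsub>semidirect_Z2 \<Lambda>\<^esub> q \<otimes>\<^bsub>semidirect_Z2 \<Lambda>\<^esub> q)" by (simp only: fst_mult q(2))
    then have "fst ?t = mat 1" using pq by (simp add: simps)
    then have "?t \<in> translation_subgroup" by (cases ?t) (simp add: translation_subgroup_def)
    moreover have "?t \<in> H" using q(1) RH' p subgroup.m_closed[OF H] subgroup.m_inv_closed[OF H] by blast
    ultimately have "?t \<in> generate (semidirect_Z2 \<Lambda>) V" using V(4) by blast
    then have "?t \<in> generate (semidirect_Z2 \<Lambda>) ?R" using G.mono_generate[of V ?R] by blast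
    then have "q \<otimes>\<^bsub>semidirect_Z2 \<Lambda>\<^esub> ?t \<in> generate (semidirect_Z2 \<Lambda>) ?R" using q(1) by simp
    then show "p \<in> generate (semidirect_Z2 \<Lambda>) ?R" using pq by (simp add: G.m_assoc[symmetric])
  qed
  then have "generate ((semidirect_Z2 \<Lambda>)\<lparr>carrier := H\<rparr>) ?R = H"
    using RH' G.generate_consistent[OF RH H] by simp
  then have "group_rank ((semidirect_Z2 \<Lambda>)\<lparr>carrier := H\<rparr>) \<le> enat (card ?R)"
    unfolding group_rank_def using RH T(2) V(2) by (intro Inf_lower CollectI exI[of _ ?R]) auto
  also have "card ?R \<le> k * card S + 2"
    using card_Un_le[of "l ` T" V] card_image_le[OF T(2), of l] T(3) V(3) by linarith
  finally have "group_rank ((semidirect_Z2 \<Lambda>)\<lparr>carrier := H\<rparr>) \<le> enat (k * card S + 2)" by simp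
  moreover have "k * subgroup_index ((semidirect_Z2 \<Lambda>)\<lparr>carrier := translation_subgroup\<rparr>)
      (H \<inter> translation_subgroup) \<le> subgroup_index (semidirect_Z2 \<Lambda>) H"
    unfolding k_def subgroup_index_def
    by (rule G.card_lcosets_mult_le[OF H K subgroup_translation_subgroup[OF \<Lambda>] HK TK fin])
  ultimately show ?thesis using k by blast
qed

text \<open>The factor k cancels: the numerator is at most k |S| + 2 \<le> k (|S| + 2), and the
  denominator is at least k i. The witness \<open>x\<close> records that the extended real quotient
  is finite.\<close>

lemma rank_gradient_bound:
  assumes H: "subgroup H (semidirect_Z2 \<Lambda>)"
    and fin: "finite (lcosets\<^bsub>semidirect_Z2 \<Lambda>\<^esub> H)"
    and S: "finite S" "S \<subseteq> carrier (semidirect_Z2 \<Lambda>)"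
      "generate (semidirect_Z2 \<Lambda>) S = carrier (semidirect_Z2 \<Lambda>)"
    and i: "i = subgroup_index ((semidirect_Z2 \<Lambda>)\<lparr>carrier := translation_subgroup\<rparr>) (H \<inter> translation_subgroup)"
      "i > 0"
  shows "\<exists>x. (ereal_of_enat (group_rank ((semidirect_Z2 \<Lambda>)\<lparr>carrier := H\<rparr>)) - 1)
           / ereal (real (subgroup_index (semidirect_Z2 \<Lambda>) H)) = ereal x \<and> \<bar>x\<bar> \<le> (real (card S) + 2) / real i"
proof -
  obtain k where k: "k \<ge> 1" "group_rank ((semidirect_Z2 \<Lambda>)\<lparr>carrier := H\<rparr>) \<le> enat (k * card S + 2)"
      "k * i \<le> subgroup_index (semidirect_Z2 \<Lambda>) H"
    using group_rank_subgroup_le[OF H fin S] unfolding i(1) by blast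
  obtain q where q: "group_rank ((semidirect_Z2 \<Lambda>)\<lparr>carrier := H\<rparr>) = enat q" "q \<le> k * card S + 2"
    using k(2) by (cases "group_rank ((semidirect_Z2 \<Lambda>)\<lparr>carrier := H\<rparr>)") auto
  let ?j = "subgroup_index (semidirect_Z2 \<Lambda>) H"
  have ki: "0 < real k * real i" using k(1) i(2) by simp
  have j: "real k * real i \<le> real ?j" using k(3) by (metis of_nat_le_iff of_nat_mult)
  have "real q \<le> real k * real (card S) + 2"
    using q(2) by (metis of_nat_add of_nat_le_iff of_nat_mult of_nat_numeral)
  moreover have "0 \<le> real k * real (card S)" by simp
  ultimately have "\<bar>real q - 1\<bar> \<le> real k * real (card S) + 2" by linarith
  also have "\<dots> \<le> real k * (real (card S) + 2)" using k(1) by (simp add: algebra_simps)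
  finally have "\<bar>real q - 1\<bar> / real ?j \<le> real k * (real (card S) + 2) / (real k * real i)"
    using ki j by (intro frac_le) auto
  also have "\<dots> = (real (card S) + 2) / real i" using k(1) by simp
  finally have "\<bar>(real q - 1) / real ?j\<bar> \<le> (real (card S) + 2) / real i" by simp
  moreover have "(ereal_of_enat (enat q) - 1) / ereal (real ?j) = ereal ((real q - 1) / real ?j)"
    using ki j by (simp add: one_ereal_def)
  ultimately show ?thesis using q(1) by (intro exI[of _ "(real q - 1) / real ?j"]) simp
qed

end

text \<open>The rank limit is conditional on finite generation: otherwise no finite-index subgroup
  is finitely generated either, and all the quotients are infinite. Extended reals accommodate the
  value infinity of \<open>group_rank\<close>.\<close>

theorem theorem1p8:
  fixes \<Lambda> :: "(int^2^2) set"
    and N :: "nat \<Rightarrow> ((int^2^2) \<times> (int^2)) set"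
  assumes "subgroup \<Lambda> SL2Z"
    and "\<exists>A\<in>\<Lambda>. hyperbolic A"
    and "\<And>n. subgroup (N n) (semidirect_Z2 \<Lambda>)"
    and "\<And>n. finite (lcosets\<^bsub>semidirect_Z2 \<Lambda>\<^esub> (N n))"
    and "filterlim (\<lambda>n. subgroup_index ((semidirect_Z2 \<Lambda>)\<lparr>carrier := translation_subgroup\<rparr>)
                          (N n \<inter> translation_subgroup)) at_top sequentially"
  shows "sofic_approximation (semidirect_Z2 \<Lambda>)
           (\<lambda>n. lcosets\<^bsub>semidirect_Z2 \<Lambda>\<^esub> (N n))
           (\<lambda>n \<gamma> C. \<gamma> <#\<^bsub>semidirect_Z2 \<Lambda>\<^esub> C) \<and>
         (finitely_generated (semidirect_Z2 \<Lambda>) \<longrightarrow>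
          (\<lambda>n. (ereal_of_enat (group_rank ((semidirect_Z2 \<Lambda>)\<lparr>carrier := N n\<rparr>)) - 1)
                / ereal (real (subgroup_index (semidirect_Z2 \<Lambda>) (N n)))) \<longlonglongrightarrow> 0)"
proof (intro conjI impI)
  interpret G: group "semidirect_Z2 \<Lambda>" by (rule group_semidirect_Z2) fact
  show "sofic_approximation (semidirect_Z2 \<Lambda>)
      (\<lambda>n. lcosets\<^bsub>semidirect_Z2 \<Lambda>\<^esub> (N n)) (\<lambda>n \<gamma> C. \<gamma> <#\<^bsub>semidirect_Z2 \<Lambda>\<^esub> C)"
  \<comment> \<open>The group is countable, consisting of pairs of integer matrices and vectors, so
    essential freeness reduces to fixed-point densities of single elements.\<close>
  proof (subst sofic_approximation_iff)
    show "lcosets\<^bsub>semidirect_Z2 \<Lambda>\<^esub> (N n) \<noteq> {}" for n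
      using G.l_coset_in_lcosets[OF G.one_closed] by blast
    show "\<forall>g\<in>carrier (semidirect_Z2 \<Lambda>) - {\<one>\<^bsub>semidirect_Z2 \<Lambda>\<^esub>}.
        (\<lambda>n. real (card {C \<in> lcosets\<^bsub>semidirect_Z2 \<Lambda>\<^esub> (N n). g <#\<^bsub>semidirect_Z2 \<Lambda>\<^esub> C = C})
            / real (card (lcosets\<^bsub>semidirect_Z2 \<Lambda>\<^esub> (N n)))) \<longlonglongrightarrow> 0"
      using fixed_density_tendsto_0[OF assms] by blast
  qed (use assms(4) in \<open>auto intro: G.l_coset_translate_in_lcosets[OF assms(3)]\<close>)
  assume "finitely_generated (semidirect_Z2 \<Lambda>)"
  then obtain S where S: "finite S" "S \<subseteq> carrier (semidirect_Z2 \<Lambda>)"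
      "generate (semidirect_Z2 \<Lambda>) S = carrier (semidirect_Z2 \<Lambda>)"
    by (auto simp: finitely_generated_def)
  define i where "i n = subgroup_index ((semidirect_Z2 \<Lambda>)\<lparr>carrier := translation_subgroup\<rparr>)
      (N n \<inter> translation_subgroup)" for n
  define f where "f n = (ereal_of_enat (group_rank ((semidirect_Z2 \<Lambda>)\<lparr>carrier := N n\<rparr>)) - 1)
      / ereal (real (subgroup_index (semidirect_Z2 \<Lambda>) (N n)))" for n
  have i: "filterlim i at_top sequentially" using assms(5) unfolding i_def .
  then have "\<forall>\<^sub>F n in sequentially. Suc 0 \<le> i n" unfolding filterlim_at_top by blast
  then have pos: "\<forall>\<^sub>F n in sequentially. 0 < i n" by (simp add: Suc_le_eq)
  \<comment> \<open>A real sequence that eventually agrees with \<open>f\<close> is extracted, so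
    that the squeeze takes place in the reals.\<close>
  have "\<exists>x. i n > 0 \<longrightarrow> f n = ereal x \<and> \<bar>x\<bar> \<le> (real (card S) + 2) / real (i n)" for n
    using rank_gradient_bound[OF assms(1,3,4) S i_def] unfolding f_def by blast
  then obtain x where x: "\<And>n. i n > 0 \<Longrightarrow> f n = ereal (x n)"
      "\<And>n. i n > 0 \<Longrightarrow> \<bar>x n\<bar> \<le> (real (card S) + 2) / real (i n)" by metis
  have "(\<lambda>n. (real (card S) + 2) / real (i n)) \<longlonglongrightarrow> 0"
    by (intro tendsto_divide_0[OF tendsto_const] filterlim_at_top_imp_at_infinity
        filterlim_compose[OF filterlim_real_sequentially i])
  then have "x \<longlonglongrightarrow> 0"
    by (rule Lim_null_comparison[rotated]) (use pos x(2) in \<open>auto elim!: eventually_mono\<close>)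
  then have "(\<lambda>n. ereal (x n)) \<longlonglongrightarrow> 0" by (simp add: zero_ereal_def)
  then have "f \<longlonglongrightarrow> 0"
    by (rule Lim_transform_eventually) (use pos x(1) in \<open>auto elim!: eventually_mono\<close>)
  then show "(\<lambda>n. (ereal_of_enat (group_rank ((semidirect_Z2 \<Lambda>)\<lparr>carrier := N n\<rparr>)) - 1)
      / ereal (real (subgroup_index (semidirect_Z2 \<Lambda>) (N n)))) \<longlonglongrightarrow> 0" unfolding f_def .
qed

end
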